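(* Let $\mu_\omega$ be the random Moran measures and $G$ the function on $[0,\infty)$ described in the context. Suppose there is a choice of $\alpha\ge0$ such that $G(\alpha)=\alpha$ and $G(\psi)<\psi$ for all $\psi>\alpha$. Then there is a set $\Gamma\subseteq\Omega$ of full measure such that $\overline{\dim}_\Phi\mu_\omega=\alpha$ for all large dimension functions $\Phi$ and all $\omega\in\Gamma$.
   Context: **Random Moran sets and measures.** Let $(\Omega,\mathcal P)$ be a probability space and fix $0<2A\le B<1$. Let $(a_n(\omega),b_n(\omega),p_n(\omega))$, $n\ge1$, be independent, identically distributed random vectors with values in $\{(x,y,z)\in[0,1]^3: A\le\min(x,y)<x+y\le B\}$ (for a fixed $n$ the three coordinates may be dependent). Assume $\mathbb E(p_n^{-t})<\infty$ and $\mathbb E((1-p_n)^{-t})<\infty$ for some $t>0$ (so almost surely $0<p_n<1$ for all $n$). The Moran interval of step $0$ is $[0,1]$. Each Moran interval $I$ of step $n-1$ has two children, which are Moran intervals of step $n$: the left child is the closed subinterval of $I$ with the same left endpoint and length $a_n(\omega)|I|$, and the right child is the closed subinterval of $I$ with the same right endpoint and length $b_n(\omega)|I|$. Here $|I|$ is the length of $I$. Let $\mathcal C_\omega^{(n)}$ be the union of the $2^n$ Moran intervals of step $n$ and $\mathcal C_\omega=\bigcap_n\mathcal C_\omega^{(n)}$. The random measure $\mu_\omega$ is the Borel probability measure on $\mathcal C_\omega$ with $\mu_\omega([0,1])=1$ such that for every Moran interval $I_N$ of step $N$, its left child has measure $p_{N+1}(\omega)\mu_\omega(I_N)$ and its right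 child has measure $(1-p_{N+1}(\omega))\mu_\omega(I_N)$. **Dimensions.** A dimension function is a map $\Phi:(0,1)\to[0,\infty)$ such that $\Psi(t)=t^{1+\Phi(t)}$ decreases to $0$ as $t$ decreases to $0$ and is doubling: there are $C_1,C_2>0$ with $\Psi(2t)\le C_1\Psi(t)$ for all $0<t<C_2$. It is large if, for $t$ near $0$, $\Phi(t)=H(t)\frac{\log|\log t|}{|\log t|}$ where $H(t)\to\infty$ as $t\to0$. For a measure $\mu$, with $B(x,r)$ the open ball of centre $x$ and radius $r$, $\overline{\dim}_\Phi\mu$ is the infimum of those $d$ for which there exist $C_1,C_2>0$ such that $\frac{\mu(B(x,R))}{\mu(B(x,r))}\le C_2\left(\frac Rr\right)^d$ for all $x\in\operatorname{supp}\mu$ and all $0<r<R^{1+\Phi(R)}\le R\le C_1$. **The function $G$.** For $\theta\ge0$ put $c_n(\theta)=\frac{a_n^\theta}{a_n^\theta+b_n^\theta}$. Define random variables $Y_n(\theta)=\log p_n$ and $Z_n(\theta)=\log a_n$ if $p_n\le c_n(\theta)$, and $Y_n(\theta)=\log(1-p_n)$ and $Z_n(\theta)=\log b_n$ if $p_n>c_n(\theta)$. Put $G(\theta)=\frac{\mathbb E(Y_1(\theta))}{\mathbb E(Z_1(\theta))}$. *)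

theory Defs
  imports "HOL-Probability.Probability"
begin

section \<open>Moran intervals, Moran sets and Moran measures\<close>

text \<open>
  An interval \<open>[u, v]\<close> is represented by its pair of endpoints \<open>(u, v)\<close>. Sequences of
  parameters are indexed by the steps \<open>1, 2, 3, \<dots>\<close>; their value at index \<open>0\<close> is never used.
\<close>

definition left_child :: "real \<Rightarrow> real \<times> real \<Rightarrow> real \<times> real" where
  "left_child x I = (fst I, fst I + x * (snd I - fst I))"

definition right_child :: "real \<Rightarrow> real \<times> real \<Rightarrow> real \<times> real" where
  "right_child y I = (snd I - y * (snd I - fst I), snd I)"

definition ivl :: "real \<times> real \<Rightarrow> real set" where
  "ivl I = {fst I..snd I}"

fun moran_intervals :: "(nat \<Rightarrow> real) \<Rightarrow> (nat \<Rightarrow> real) \<Rightarrow> nat \<Rightarrow> (real \<times> real) set" where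
  "moran_intervals a b 0 = {(0, 1)}"
| "moran_intervals a b (Suc n) =
     left_child (a (Suc n)) ` moran_intervals a b n \<union>
     right_child (b (Suc n)) ` moran_intervals a b n"

definition moran_step :: "(nat \<Rightarrow> real) \<Rightarrow> (nat \<Rightarrow> real) \<Rightarrow> nat \<Rightarrow> real set" where
  "moran_step a b n = (\<Union>I\<in>moran_intervals a b n. ivl I)"

definition moran_set :: "(nat \<Rightarrow> real) \<Rightarrow> (nat \<Rightarrow> real) \<Rightarrow> real set" where
  "moran_set a b = (\<Inter>n. moran_step a b n)"

text \<open>
  The measure is carried by the Moran set but is regarded as a Borel measure on the real line.
  For parameters in the range considered, the conditions below determine it uniquely.
\<close>

definition moran_measure ::
  "(nat \<Rightarrow> real) \<Rightarrow> (nat \<Rightarrow> real) \<Rightarrow> (nat \<Rightarrow> real) \<Rightarrow> real measure \<Rightarrow> bool" where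
  "moran_measure a b p m \<longleftrightarrow>
     prob_space m \<and> sets m = sets borel \<and>
     measure m (moran_set a b) = 1 \<and> measure m {0..1} = 1 \<and>
     (\<forall>N. \<forall>I\<in>moran_intervals a b N.
        measure m (ivl (left_child (a (Suc N)) I)) = p (Suc N) * measure m (ivl I) \<and>
        measure m (ivl (right_child (b (Suc N)) I)) = (1 - p (Suc N)) * measure m (ivl I))"


section \<open>Dimension functions and the upper dimension of a measure\<close>

text \<open>
  A dimension function is a map on \<open>(0, 1)\<close>; its values elsewhere are irrelevant. For this reason
  the thresholds \<open>C2\<close> (doubling) and \<open>C1\<close> (in the dimension) are bounded so that only arguments
  in \<open>(0, 1)\<close> occur. Nothing is lost, since both conditions are preserved when the threshold is
  decreased.
\<close>

definition dimension_function :: "(real \<Rightarrow> real) \<Rightarrow> bool" where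
  "dimension_function \<Phi> \<longleftrightarrow>
     (\<forall>t\<in>{0<..<1}. 0 \<le> \<Phi> t) \<and>
     (let \<Psi> = (\<lambda>t. t powr (1 + \<Phi> t)) in
        mono_on {0<..<1} \<Psi> \<and> (\<Psi> \<longlongrightarrow> 0) (at_right 0) \<and>
        (\<exists>C1>0. \<exists>C2>0. C2 \<le> 1 / 2 \<and> (\<forall>t. 0 < t \<and> t < C2 \<longrightarrow> \<Psi> (2 * t) \<le> C1 * \<Psi> t)))"

definition large_dimension_function :: "(real \<Rightarrow> real) \<Rightarrow> bool" where
  "large_dimension_function \<Phi> \<longleftrightarrow>
     dimension_function \<Phi> \<and>
     (\<exists>H :: real \<Rightarrow> real. filterlim H at_top (at_right 0) \<and>
        (\<forall>\<^sub>F t in at_right 0. \<Phi> t = H t * (ln \<bar>ln t\<bar> / \<bar>ln t\<bar>)))"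

definition measure_support :: "'a :: metric_space measure \<Rightarrow> 'a set" where
  "measure_support \<mu> = {x. \<forall>r>0. emeasure \<mu> (ball x r) > 0}"

text \<open>
  The infimum is taken in the extended reals, so that it is \<open>\<infinity>\<close> when there is no admissible
  exponent. For a finite measure the denominators below are positive, by definition of the
  support.
\<close>

definition upper_dim :: "(real \<Rightarrow> real) \<Rightarrow> 'a :: metric_space measure \<Rightarrow> ereal" where
  "upper_dim \<Phi> \<mu> = Inf {ereal d | d :: real.
     \<exists>C1>0. \<exists>C2>0. C1 < 1 \<and>
       (\<forall>x\<in>measure_support \<mu>. \<forall>r R.
          0 < r \<and> r < R powr (1 + \<Phi> R) \<and> R powr (1 + \<Phi> R) \<le> R \<and> R \<le> C1 \<longrightarrow>
          measure \<mu> (ball x R) / measure \<mu> (ball x r) \<le> C2 * (R / r) powr d)}"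


section \<open>The function G\<close>

definition ratio_c :: "real \<Rightarrow> real \<Rightarrow> real \<Rightarrow> real" where
  "ratio_c \<theta> x y = x powr \<theta> / (x powr \<theta> + y powr \<theta>)"

text \<open>
  In the two definitions below, the arguments \<open>x\<close>, \<open>y\<close>, \<open>z\<close> stand for \<open>a\<^sub>n\<close>, \<open>b\<^sub>n\<close>, \<open>p\<^sub>n\<close>.
  The convention \<open>ln 0 = 0\<close> is immaterial: the moment conditions on \<open>p\<^sub>n\<close> and \<open>1 - p\<^sub>n\<close> give
  \<open>0 < p\<^sub>n < 1\<close> almost surely.
\<close>

definition Y_val :: "real \<Rightarrow> real \<Rightarrow> real \<Rightarrow> real \<Rightarrow> real" where
  "Y_val \<theta> x y z = (if z \<le> ratio_c \<theta> x y then ln z else ln (1 - z))"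

definition Z_val :: "real \<Rightarrow> real \<Rightarrow> real \<Rightarrow> real \<Rightarrow> real" where
  "Z_val \<theta> x y z = (if z \<le> ratio_c \<theta> x y then ln x else ln y)"

definition G_fun ::
  "'w measure \<Rightarrow> (nat \<Rightarrow> 'w \<Rightarrow> real) \<Rightarrow> (nat \<Rightarrow> 'w \<Rightarrow> real) \<Rightarrow> (nat \<Rightarrow> 'w \<Rightarrow> real) \<Rightarrow> real \<Rightarrow> real" where
  "G_fun M a b p \<theta> =
     (\<integral>\<omega>. Y_val \<theta> (a 1 \<omega>) (b 1 \<omega>) (p 1 \<omega>) \<partial>M) / (\<integral>\<omega>. Z_val \<theta> (a 1 \<omega>) (b 1 \<omega>) (p 1 \<omega>) \<partial>M)"


section \<open>The random parameters\<close>

text \<open>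
  The moments \<open>E(p\<^sub>n\<^sup>-\<^sup>t)\<close> and \<open>E((1 - p\<^sub>n)\<^sup>-\<^sup>t)\<close> are taken in the extended nonnegative reals, where
  \<open>inverse 0 = \<infinity>\<close>; real powers would wrongly give the value \<open>0\<close> at \<open>0\<close>.
\<close>

definition random_moran_parameters ::
  "'w measure \<Rightarrow> real \<Rightarrow> real \<Rightarrow>
    (nat \<Rightarrow> 'w \<Rightarrow> real) \<Rightarrow> (nat \<Rightarrow> 'w \<Rightarrow> real) \<Rightarrow> (nat \<Rightarrow> 'w \<Rightarrow> real) \<Rightarrow> bool" where
  "random_moran_parameters M A B a b p \<longleftrightarrow>
     prob_space M \<and> 0 < 2 * A \<and> 2 * A \<le> B \<and> B < 1 \<and>
     prob_space.indep_vars M (\<lambda>_. borel) (\<lambda>n \<omega>. (a n \<omega>, b n \<omega>, p n \<omega>)) {1..} \<and>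
     (\<forall>n\<ge>1. distr M borel (\<lambda>\<omega>. (a n \<omega>, b n \<omega>, p n \<omega>)) = distr M borel (\<lambda>\<omega>. (a 1 \<omega>, b 1 \<omega>, p 1 \<omega>))) \<and>
     (\<forall>n\<ge>1. \<forall>\<omega>\<in>space M.
        a n \<omega> \<in> {0..1} \<and> b n \<omega> \<in> {0..1} \<and> p n \<omega> \<in> {0..1} \<and>
        A \<le> min (a n \<omega>) (b n \<omega>) \<and> min (a n \<omega>) (b n \<omega>) < a n \<omega> + b n \<omega> \<and> a n \<omega> + b n \<omega> \<le> B) \<and>
     (\<exists>t>0. \<forall>n\<ge>1.
        (\<integral>\<^sup>+\<omega>. inverse (ennreal (p n \<omega> powr t)) \<partial>M) < \<infinity> \<and>
        (\<integral>\<^sup>+\<omega>. inverse (ennreal ((1 - p n \<omega>) powr t)) \<partial>M) < \<infinity>)"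

end

theory Submission
  imports Defs
begin

text \<open>
  Fix \<open>d\<close> and look at one step of the construction. Passing to the left child multiplies
  \<open>\<mu>(I) / |I|^d\<close> by \<open>p / a^d\<close>, passing to the right child multiplies it by \<open>(1 - p) / b^d\<close>, and the
  smaller of the two factors is always \<open>exp (Y(d) - d Z(d))\<close>: the threshold \<open>c(d)\<close> is the value of
  \<open>p\<close> at which they agree. So the child prescribed by \<open>Y(d)\<close> and \<open>Z(d)\<close> is the one on which the
  measure drops most steeply compared with the \<open>d\<close>-th power of the length. Since
  \<open>E (d Z(d) - Y(d)) = E Z(d) (d - G(d))\<close> and \<open>E Z(d) < 0\<close>, the sign of \<open>G(d) - d\<close> decides whether
  the steepest descent is, in the mean, steeper than the exponent \<open>d\<close>.

  Upper bound. Let \<open>d > \<alpha>\<close>. Then \<open>X = d Z(d) - Y(d)\<close> has negative mean and, by the moment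
  conditions, an exponential moment. Chernoff's bound gives \<open>P (X_{N+1} + \<dots> + X_{N+n} \<ge> 0) \<le> \<rho>^n\<close>
  with \<open>\<rho> < 1\<close>, for every \<open>N\<close>. For fixed \<open>n\<close> one can therefore afford exponentially many starting
  points \<open>N \<le> \<sigma>^n\<close>, where \<open>\<sigma> \<rho> < 1\<close>, and Borel-Cantelli shows that almost surely all these block
  sums are negative for large \<open>n\<close> (\<open>block_sums_eventually_negative\<close>). A Moran interval of length
  comparable to \<open>R\<close> has step \<open>N\<close> of order at most \<open>|log R|\<close>. If \<open>\<Phi>\<close> is large and
  \<open>r < R^(1 + \<Phi> R)\<close>, the interval of length comparable to \<open>r\<close> is at least a large multiple of
  \<open>log |log R|\<close> steps further down, so the block between the two scales satisfies \<open>N \<le> \<sigma>^n\<close>.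
  The gaps between Moran intervals make balls centred in the support comparable to Moran intervals,
  and \<open>d\<close> is admissible (\<open>upper_dim_le\<close>).

  Lower bound. Follow the steepest descent for the exponent \<open>\<alpha>\<close> from the root to a point \<open>x\<close>. For
  \<open>d < \<alpha>\<close> the steps \<open>Y(\<alpha>) - d Z(\<alpha>)\<close> have mean \<open>(\<alpha> - d) E Z(\<alpha>) < 0\<close>, so almost surely
  \<open>\<mu>(I_n) \<le> |I_n|^d exp (- \<delta> n)\<close> along this path for large \<open>n\<close>. Keeping \<open>R\<close> fixed and letting
  \<open>r\<close> tend to \<open>0\<close> shows that \<open>d\<close> is not admissible, whatever \<open>\<Phi>\<close> is (\<open>upper_dim_ge\<close>).

  The exceptional null sets depend on \<open>d\<close> only, and it suffices to let \<open>d\<close> run through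
  two sequences that converge to \<open>\<alpha>\<close>; this gives one set of full measure for all \<open>\<Phi>\<close>.
\<close>

section \<open>Moran intervals as paths in the binary tree\<close>

definition ivl_length :: "real \<times> real \<Rightarrow> real" where
  "ivl_length I = snd I - fst I"

text \<open>
  A Moran interval is reached from the root by a sequence of choices, where \<open>True\<close> stands for left.
  The choice made at step \<open>n\<close> is \<open>w n\<close>, in accordance with the numbering of the parameters.
\<close>

primrec path_ivl ::
  "(nat \<Rightarrow> real) \<Rightarrow> (nat \<Rightarrow> real) \<Rightarrow> (nat \<Rightarrow> bool) \<Rightarrow> nat \<Rightarrow> real \<times> real" where
  "path_ivl a b w 0 = (0, 1)"
| "path_ivl a b w (Suc n) =
     (if w (Suc n) then left_child (a (Suc n)) (path_ivl a b w n)
      else right_child (b (Suc n)) (path_ivl a b w n))"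

lemma path_ivl_cong: "(\<And>i. 1 \<le> i \<Longrightarrow> i \<le> n \<Longrightarrow> v i = w i) \<Longrightarrow> path_ivl a b v n = path_ivl a b w n"
  by (induction n) auto

lemma path_ivl_mem: "path_ivl a b w n \<in> moran_intervals a b n"
  by (induction n) auto

lemma moran_intervals_eq: "moran_intervals a b n = range (\<lambda>w. path_ivl a b w n)"
proof
  show "moran_intervals a b n \<subseteq> range (\<lambda>w. path_ivl a b w n)"
  proof (induction n)
    case (Suc n)
    have *: "path_ivl a b (w(Suc n := c)) n = path_ivl a b w n" for w c
      by (rule path_ivl_cong) auto
    have "left_child (a (Suc n)) (path_ivl a b w n) \<in> range (\<lambda>w. path_ivl a b w (Suc n))" for w
      by (rule range_eqI[of _ _ "w(Suc n := True)"]) (simp add: *)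
    moreover have "right_child (b (Suc n)) (path_ivl a b w n) \<in> range (\<lambda>w. path_ivl a b w (Suc n))" for w
      by (rule range_eqI[of _ _ "w(Suc n := False)"]) (simp add: *)
    ultimately show ?case
      using Suc.IH by (auto simp del: path_ivl.simps)
  qed simp
qed (auto intro: path_ivl_mem)

lemma ivl_length_path:
  "ivl_length (path_ivl a b w n) = (\<Prod>i=1..n. if w i then a i else b i)"
proof (induction n)
  case (Suc n)
  have "ivl_length (path_ivl a b w (Suc n)) =
      ivl_length (path_ivl a b w n) * (if w (Suc n) then a (Suc n) else b (Suc n))"
    by (simp add: ivl_length_def left_child_def right_child_def)
  then show ?case using Suc.IH by simp
qed (simp add: ivl_length_def)

lemma measure_path_ivl:
  assumes "moran_measure a b p m"
  shows "measure m (ivl (path_ivl a b w n)) = (\<Prod>i=1..n. if w i then p i else 1 - p i)"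
proof (induction n)
  case 0
  then show ?case using assms by (simp add: moran_measure_def ivl_def)
next
  case (Suc n)
  have "measure m (ivl (path_ivl a b w (Suc n))) =
      (if w (Suc n) then p (Suc n) else 1 - p (Suc n)) * measure m (ivl (path_ivl a b w n))"
    using assms path_ivl_mem[of a b w n] by (auto simp: moran_measure_def)
  then show ?case using Suc.IH by simp
qed

lemma closed_moran_set: "closed (moran_set a b)"
proof -
  have "finite (moran_intervals a b n)" for n
    by (induction n) auto
  then show ?thesis
    unfolding moran_set_def moran_step_def ivl_def by (intro closed_INT closed_UN ballI) auto
qed

text \<open>
  The complement of \<open>S\<close> is an open null set, and by definition no point of the support has a ball of
  measure zero around it.
\<close>

lemma support_subset_closed_full:
  fixes m :: "'a::metric_space measure"
  assumes "prob_space m" and s: "sets m = sets borel" and "closed S" and S: "measure m S = 1"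
  shows "measure_support m \<subseteq> S"
proof
  interpret prob_space m by fact
  fix x assume x: "x \<in> measure_support m"
  show "x \<in> S"
  proof (rule ccontr)
    assume "x \<notin> S"
    then obtain r where r: "r > 0" "ball x r \<subseteq> - S"
      using \<open>closed S\<close> by (metis ComplI open_Compl open_contains_ball)
    have [measurable]: "S \<in> sets m" "ball x r \<in> sets m"
      using s \<open>closed S\<close> by auto
    have "AE y in m. y \<in> S"
      using S by (simp add: prob_eq_1)
    then have "AE y in m. y \<notin> ball x r"
      by eventually_elim (use r in auto)
    then have "emeasure m (ball x r) = 0"
      by (subst (asm) AE_iff_measurable[where N="ball x r"])
         (use sets.sets_into_space[of "ball x r" m] in auto)
    then show False using x r by (auto simp: measure_support_def)
  qed
qed

locale moran_ratios =
  fixes A B :: real and a b :: "nat \<Rightarrow> real"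
  assumes A_pos: "0 < A" and B_less_1: "B < 1"
    and ratios: "1 \<le> n \<Longrightarrow> A \<le> a n" "1 \<le> n \<Longrightarrow> A \<le> b n" "1 \<le> n \<Longrightarrow> a n + b n \<le> B"
begin

abbreviation ivl_at :: "(nat \<Rightarrow> bool) \<Rightarrow> nat \<Rightarrow> real \<times> real" where
  "ivl_at \<equiv> path_ivl a b"

abbreviation len :: "(nat \<Rightarrow> bool) \<Rightarrow> nat \<Rightarrow> real" where
  "len w n \<equiv> ivl_length (ivl_at w n)"

lemma B_pos: "0 < B"
  using ratios[of 1] A_pos by simp

lemma len_0: "len w 0 = 1"
  by (simp add: ivl_length_def)

lemma len_pos: "0 < len w n"
  unfolding ivl_length_path using less_le_trans[OF A_pos ratios(1)] less_le_trans[OF A_pos ratios(2)]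
  by (intro prod_pos) simp

lemma len_Suc: "A * len w n \<le> len w (Suc n)" "len w (Suc n) \<le> B * len w n"
proof -
  have eq: "len w (Suc n) = (if w (Suc n) then a (Suc n) else b (Suc n)) * len w n"
    by (simp add: ivl_length_def left_child_def right_child_def)
  show "A * len w n \<le> len w (Suc n)" "len w (Suc n) \<le> B * len w n"
    unfolding eq using ratios[of "Suc n"] A_pos len_pos[of w n]
    by (auto intro!: mult_right_mono)
qed

lemma len_antimono: "m \<le> n \<Longrightarrow> len w n \<le> len w m"
proof (induction n rule: dec_induct)
  case (step n)
  have "len w (Suc n) \<le> 1 * len w n"
    using len_Suc(2)[of w n] B_less_1 len_pos[of w n] by (intro order_trans[OF len_Suc(2)] mult_right_mono) auto
  then show ?case using step by simp
qed simp

lemma len_le_power: "len w n \<le> B ^ n"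
proof (induction n)
  case (Suc n)
  then have "B * len w n \<le> B * B ^ n" using B_pos by simp
  then show ?case using len_Suc(2)[of w n] by simp
qed (simp add: ivl_length_def)

lemma len_ge_power: "A ^ n * len w m \<le> len w (m + n)"
proof (induction n)
  case (Suc n)
  then have "A * (A ^ n * len w m) \<le> A * len w (m + n)" using A_pos by simp
  then show ?case using len_Suc(1)[of w "m + n"] by (simp add: mult_ac)
qed simp

lemma len_tendsto_0: "len w \<longlonglongrightarrow> 0"
proof (rule tendsto_sandwich[OF _ _ tendsto_const])
  show "(\<lambda>n. B ^ n) \<longlonglongrightarrow> 0" using B_pos B_less_1 by (intro LIMSEQ_power_zero) auto
qed (auto simp: len_le_power less_imp_le[OF len_pos])

lemma ivl_Suc_subset: "ivl (ivl_at w (Suc n)) \<subseteq> ivl (ivl_at w n)"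
proof -
  have *: "c * len w n \<le> len w n" if "c \<le> 1" for c
    using that mult_right_mono[of c 1 "len w n"] len_pos[of w n] by simp
  have "0 < a (Suc n)" "0 < b (Suc n)" "a (Suc n) \<le> 1" "b (Suc n) \<le> 1"
    using ratios[of "Suc n"] A_pos B_less_1 by auto
  then have "a (Suc n) * len w n \<le> len w n" "0 < a (Suc n) * len w n"
    "b (Suc n) * len w n \<le> len w n" "0 < b (Suc n) * len w n"
    using *[of "a (Suc n)"] *[of "b (Suc n)"] len_pos[of w n] by auto
  note bounds = this[unfolded ivl_length_def]
  show ?thesis
    by (auto simp: ivl_def left_child_def right_child_def) (use bounds in linarith)+
qed

lemma ivl_antimono: "m \<le> n \<Longrightarrow> ivl (ivl_at w n) \<subseteq> ivl (ivl_at w m)"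
  by (induction n rule: dec_induct) (use ivl_Suc_subset in blast)+

lemma ivl_mem_dist: "x \<in> ivl (ivl_at w n) \<Longrightarrow> y \<in> ivl (ivl_at w n) \<Longrightarrow> dist x y \<le> len w n"
  by (auto simp: ivl_def ivl_length_def dist_real_def)

text \<open>
  At the step where two paths separate, their intervals lie in different children of a common
  interval and hence have a gap of at least \<open>1 - B\<close> times its length between them. Two points closer
  than the corresponding gap at step \<open>n\<close> therefore share their first \<open>n\<close> choices. With \<open>x = y\<close> this
  says that the address of a point is unique.
\<close>

lemma paths_agree:
  assumes x: "x \<in> ivl (ivl_at w n)" and y: "y \<in> ivl (ivl_at v n)"
    and close: "dist x y < (1 - B) * len w (n - 1)"
    and "1 \<le> i" "i \<le> n"
  shows "v i = w i"
proof -
  have "j \<le> n \<Longrightarrow> \<forall>i\<in>{1..j}. v i = w i" for j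
  proof (induction j)
    case (Suc j)
    then have agree: "\<forall>i\<in>{1..j}. v i = w i" by simp
    then have eq: "ivl_at v j = ivl_at w j" by (intro path_ivl_cong) auto
    have xj: "x \<in> ivl (ivl_at w (Suc j))" and yj: "y \<in> ivl (ivl_at v (Suc j))"
      using x y ivl_antimono[OF Suc.prems] by blast+
    have gap: "a (Suc j) * len w j + b (Suc j) * len w j \<le> B * len w j"
      using ratios(3)[of "Suc j"] len_pos[of w j]
      by (metis distrib_right le_add1 less_imp_le mult_right_mono plus_1_eq_Suc)
    have "(1 - B) * len w (n - 1) \<le> (1 - B) * len w j"
      using Suc.prems B_less_1 by (intro mult_left_mono len_antimono) auto
    then have "dist x y < len w j - B * len w j" using close by (simp add: algebra_simps)
    then have "v (Suc j) = w (Suc j)"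
      using xj yj eq gap
      by (auto simp: ivl_def ivl_length_def left_child_def right_child_def dist_real_def split: if_splits)
    then show ?case using agree by (auto simp: le_Suc_eq)
  qed simp
  then show ?thesis using assms(4,5) by auto
qed

text \<open>
  Membership gives a path for each \<open>n\<close> separately; by uniqueness of addresses these paths are
  compatible, and their diagonal is a single infinite path.
\<close>

lemma moran_set_imp_path:
  assumes "x \<in> moran_set a b"
  obtains w where "\<And>n. x \<in> ivl (ivl_at w n)"
proof -
  have "\<forall>n. \<exists>w. x \<in> ivl (ivl_at w n)"
    using assms by (auto simp: moran_set_def moran_step_def moran_intervals_eq)
  then obtain v where v: "\<And>n. x \<in> ivl (ivl_at (v n) n)" by metis
  define w where "w i = v i i" for i
  have "x \<in> ivl (ivl_at w n)" for n
  proof -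
    have "v n i = v i i" if "1 \<le> i" "i \<le> n" for i
    proof (rule paths_agree[where x=x and y=x and n=i and i=i and v="v n" and w="v i"])
      show "x \<in> ivl (ivl_at (v i) i)" "x \<in> ivl (ivl_at (v n) i)"
        using v ivl_antimono[OF that(2)] by blast+
      show "dist x x < (1 - B) * len (v i) (i - 1)"
        using B_less_1 len_pos by simp
    qed (use that in auto)
    then have "ivl_at w n = ivl_at (v n) n" unfolding w_def by (intro path_ivl_cong) auto
    then show ?thesis using v by simp
  qed
  then show ?thesis by (rule that)
qed

lemma path_has_limit: obtains x where "\<And>n. x \<in> ivl (ivl_at w n)"
proof -
  have "\<Inter>(range (\<lambda>n. ivl (ivl_at w n))) \<noteq> {}"
  proof (rule compact_nest)
    show "ivl (ivl_at w n) \<noteq> {}" for n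
      using len_pos[of w n] by (simp add: ivl_def ivl_length_def)
    show "compact (ivl (ivl_at w n))" for n
      by (simp add: ivl_def)
  qed (rule ivl_antimono)
  then show ?thesis using that by auto
qed

end

locale moran_system = moran_ratios +
  fixes p :: "nat \<Rightarrow> real" and m :: "real measure"
  assumes moran: "moran_measure a b p m"
    and weights: "1 \<le> n \<Longrightarrow> 0 < p n" "1 \<le> n \<Longrightarrow> p n < 1"
begin

sublocale prob_space m
  using moran by (simp add: moran_measure_def)

lemma sets_m [measurable_cong]: "sets m = sets borel"
  using moran by (simp add: moran_measure_def)

abbreviation mass :: "(nat \<Rightarrow> bool) \<Rightarrow> nat \<Rightarrow> real" where
  "mass w n \<equiv> measure m (ivl (ivl_at w n))"

lemma mass_pos: "0 < mass w n"
  unfolding measure_path_ivl[OF moran] using weights by (intro prod_pos) auto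

lemma ln_mass: "ln (mass w n) = (\<Sum>i=1..n. ln (if w i then p i else 1 - p i))"
  unfolding measure_path_ivl[OF moran] using weights by (intro ln_prod) (simp_all add: less_imp_neq[THEN not_sym] less_imp_neq)

lemma ln_len: "ln (len w n) = (\<Sum>i=1..n. ln (if w i then a i else b i))"
  unfolding ivl_length_path using less_le_trans[OF A_pos ratios(1)] less_le_trans[OF A_pos ratios(2)]
  by (intro ln_prod) (simp_all add: less_imp_neq[THEN not_sym])

lemma ivl_subset_ball:
  assumes "x \<in> ivl (ivl_at w n)" "len w n < r"
  shows "mass w n \<le> measure m (ball x r)"
proof (rule finite_measure_mono)
  show "ivl (ivl_at w n) \<subseteq> ball x r"
    using ivl_mem_dist[OF assms(1)] assms(2) by (force simp: dist_commute)
qed (simp add: sets_m)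

text \<open>
  If the radius is at most the gap that isolates the interval of step \<open>n\<close>, the ball meets the
  Moran set only inside this interval.
\<close>

lemma ball_le_mass:
  assumes x: "\<And>n. x \<in> ivl (ivl_at w n)" and r: "r \<le> (1 - B) * len w (n - 1)"
  shows "measure m (ball x r) \<le> mass w n"
proof -
  have full: "AE y in m. y \<in> moran_set a b"
    using moran closed_moran_set[of a b] by (subst prob_eq_1[symmetric]) (auto simp: moran_measure_def sets_m)
  have "y \<in> ivl (ivl_at w n)" if y: "y \<in> moran_set a b" "y \<in> ball x r" for y
  proof -
    obtain v where v: "\<And>n. y \<in> ivl (ivl_at v n)" using moran_set_imp_path[OF y(1)] by metis
    have "ivl_at v n = ivl_at w n"
      by (rule path_ivl_cong, rule paths_agree[OF x v]) (use y r in auto)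
    then show ?thesis using v[of n] by simp
  qed
  then show ?thesis
    using full by (intro finite_measure_mono_AE) (auto simp: sets_m ivl_def)
qed

lemma support_imp_path:
  assumes "x \<in> measure_support m"
  obtains w where "\<And>n. x \<in> ivl (ivl_at w n)"
proof -
  have "measure_support m \<subseteq> moran_set a b"
    using moran prob_space_axioms
    by (intro support_subset_closed_full closed_moran_set) (auto simp: moran_measure_def)
  then show ?thesis using assms moran_set_imp_path that by blast
qed

lemma path_imp_support:
  assumes "\<And>n. x \<in> ivl (ivl_at w n)"
  shows "x \<in> measure_support m"
proof -
  have "0 < emeasure m (ball x r)" if "0 < r" for r
  proof -
    obtain n where "len w n < r"
      using order_tendstoD(2)[OF len_tendsto_0 \<open>0 < r\<close>] by (auto simp: eventually_sequentially)
    then have "0 < measure m (ball x r)"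
      using mass_pos[of w n] ivl_subset_ball[OF assms] by fastforce
    then show ?thesis by (simp add: emeasure_eq_measure)
  qed
  then show ?thesis by (simp add: measure_support_def)
qed

end

section \<open>Block sums with an exponential moment and negative mean\<close>

context prob_space
begin

text \<open>
  The function \<open>s \<mapsto> E (exp (s X))\<close> has the value \<open>1\<close> and the derivative \<open>E X < 0\<close> at \<open>0\<close>. The
  difference quotients converge under the expectation by dominated convergence: by convexity of
  the exponential function they increase with \<open>s\<close>, hence lie between \<open>X\<close> and the quotient at \<open>s0\<close>.
\<close>

lemma exp_moment_less_1:
  fixes X :: "'a \<Rightarrow> real"
  assumes X: "integrable M X" and neg: "expectation X < 0"
    and s0: "0 < s0" "integrable M (\<lambda>\<omega>. exp (s0 * X \<omega>))"
  obtains s where "0 < s" "integrable M (\<lambda>\<omega>. exp (s * X \<omega>))" "expectation (\<lambda>\<omega>. exp (s * X \<omega>)) < 1"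
proof -
  define q where "q s x = (exp (s * x) - 1) / s" for s x :: real
  define s where "s k = s0 / real (Suc k)" for k
  have s_pos: "0 < s k" and s_le: "s k \<le> s0" for k
    using s0 by (auto simp: s_def field_simps)
  have s_lim: "s \<longlonglongrightarrow> 0"
    unfolding s_def by (rule LIMSEQ_Suc[OF lim_const_over_n])
  have bound: "\<bar>q (s k) x\<bar> \<le> \<bar>x\<bar> + (exp (s0 * x) + 1) / s0" for k x
  proof -
    define t where "t = s k / s0"
    have t: "0 \<le> t" "t \<le> 1" "s k = t * s0" "0 < t"
      using s_pos[of k] s_le[of k] s0 by (auto simp: t_def)
    have "exp ((1 - t) *\<^sub>R 0 + t *\<^sub>R (s0 * x)) \<le> (1 - t) * exp 0 + t * exp (s0 * x)"
      by (rule convex_onD[OF exp_convex]) (use t in auto)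
    then have "exp (s k * x) - 1 \<le> t * (exp (s0 * x) - 1)"
      using t by (simp add: algebra_simps)
    then have "q (s k) x \<le> t * (exp (s0 * x) - 1) / s k"
      unfolding q_def using s_pos[of k] by (intro divide_right_mono) auto
    also have "\<dots> = (exp (s0 * x) - 1) / s0" using t s0 by (simp add: field_simps)
    also have "\<dots> \<le> (exp (s0 * x) + 1) / s0" using s0 by (intro divide_right_mono) auto
    finally have up: "q (s k) x \<le> (exp (s0 * x) + 1) / s0" .
    have "x \<le> q (s k) x"
      unfolding q_def using exp_ge_add_one_self[of "s k * x"] s_pos[of k] by (simp add: field_simps)
    moreover have "0 \<le> (exp (s0 * x) + 1) / s0" using s0 by (simp add: add_nonneg_nonneg)
    ultimately show ?thesis using up by linarith
  qed
  have [measurable]: "X \<in> borel_measurable M" using X by simp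
  have [measurable]: "(\<lambda>\<omega>. q (s k) (X \<omega>)) \<in> borel_measurable M" for k
    unfolding q_def by measurable
  have dom: "integrable M (\<lambda>\<omega>. \<bar>X \<omega>\<bar> + (exp (s0 * X \<omega>) + 1) / s0)"
    using X s0 by (intro Bochner_Integration.integrable_add integrable_divide integrable_abs) auto
  have "(\<lambda>k. expectation (\<lambda>\<omega>. q (s k) (X \<omega>))) \<longlonglongrightarrow> expectation X"
  proof (rule integral_dominated_convergence[OF _ _ dom])
    have "(\<lambda>k. q (s k) x) \<longlonglongrightarrow> x" for x
    proof -
      have "((\<lambda>u. exp (u * x)) has_real_derivative x) (at 0)"
        by (auto intro!: derivative_eq_intros)
      then have "((\<lambda>u. (exp (u * x) - 1) / u) \<longlongrightarrow> x) (at 0)"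
        by (simp add: has_field_derivative_iff)
      then show ?thesis
        unfolding q_def by (rule filterlim_compose)
          (use s_lim s_pos in \<open>auto simp: filterlim_at less_imp_neq[THEN not_sym]\<close>)
    qed
    then show "AE \<omega> in M. (\<lambda>k. q (s k) (X \<omega>)) \<longlonglongrightarrow> X \<omega>" by simp
  qed (auto simp: bound)
  from order_tendstoD(2)[OF this neg] obtain k where k: "expectation (\<lambda>\<omega>. q (s k) (X \<omega>)) < 0"
    by (auto simp: eventually_sequentially)
  have int: "integrable M (\<lambda>\<omega>. q (s k) (X \<omega>))"
    by (rule Bochner_Integration.integrable_bound[OF dom]) (auto intro!: AE_I2 order_trans[OF bound])
  have eq: "exp (s k * x) = 1 + s k * q (s k) x" for x
    using s_pos[of k] by (simp add: q_def)
  show ?thesis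
  proof (rule that[OF s_pos[of k]])
    show "integrable M (\<lambda>\<omega>. exp (s k * X \<omega>))"
      unfolding eq using int by auto
    have "expectation (\<lambda>\<omega>. exp (s k * X \<omega>)) = 1 + s k * expectation (\<lambda>\<omega>. q (s k) (X \<omega>))"
      unfolding eq using int by (simp add: prob_space)
    then show "expectation (\<lambda>\<omega>. exp (s k * X \<omega>)) < 1"
      using k s_pos[of k] by (simp add: mult_pos_neg)
  qed
qed

lemma chernoff_bound:
  fixes X :: "nat \<Rightarrow> 'a \<Rightarrow> real"
  assumes indep: "indep_vars (\<lambda>_. borel) X J" and "finite J" and "0 \<le> \<rho>"
    and moment: "\<And>i. i \<in> J \<Longrightarrow> (\<integral>\<^sup>+\<omega>. ennreal (exp (s * X i \<omega>)) \<partial>M) = ennreal \<rho>" and "0 < s"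
  shows "prob {\<omega>\<in>space M. 0 \<le> (\<Sum>i\<in>J. X i \<omega>)} \<le> \<rho> ^ card J"
proof -
  have [measurable]: "X i \<in> borel_measurable M" if "i \<in> J" for i
    using indep that by (auto simp: indep_vars_def)
  have "emeasure M {\<omega>\<in>space M. 0 \<le> (\<Sum>i\<in>J. X i \<omega>)} =
      emeasure M {\<omega>\<in>space M. 1 \<le> 1 * ennreal (exp (s * (\<Sum>i\<in>J. X i \<omega>)))}"
    using \<open>0 < s\<close> by (intro arg_cong[where f="emeasure M"]) (auto simp: zero_le_mult_iff)
  also have "\<dots> \<le> 1 * (\<integral>\<^sup>+\<omega>. ennreal (exp (s * (\<Sum>i\<in>J. X i \<omega>))) * indicator (space M) \<omega> \<partial>M)"
    by (rule nn_integral_Markov_inequality) auto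
  also have "\<dots> = (\<integral>\<^sup>+\<omega>. (\<Prod>i\<in>J. ennreal (exp (s * X i \<omega>))) \<partial>M)"
    using \<open>finite J\<close> by (auto simp: sum_distrib_left exp_sum prod_ennreal intro!: nn_integral_cong)
  also have "\<dots> = (\<Prod>i\<in>J. \<integral>\<^sup>+\<omega>. ennreal (exp (s * X i \<omega>)) \<partial>M)"
    by (intro indep_vars_nn_integral indep_vars_compose2[OF indep] \<open>finite J\<close>) auto
  also have "\<dots> = ennreal (\<rho> ^ card J)"
    using moment \<open>0 \<le> \<rho>\<close> by (simp add: ennreal_power)
  finally show ?thesis
    using \<open>0 \<le> \<rho>\<close> by (simp add: emeasure_eq_measure)
qed

text \<open>
  For a given length \<open>n\<close>, a union bound over the starting points \<open>N \<le> \<sigma>^n\<close> costs a factor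
  \<open>\<sigma>^n + 1\<close> against the Chernoff bound \<open>\<rho>^n\<close>. Choosing \<open>\<sigma> > 1\<close> with \<open>\<sigma> \<rho> < 1\<close> keeps the
  probabilities summable. That \<open>N\<close> may be exponentially large in \<open>n\<close> is what makes blocks of length
  a multiple of \<open>log N\<close> accessible.
\<close>

lemma block_sums_eventually_negative:
  fixes X :: "nat \<Rightarrow> 'a \<Rightarrow> real"
  assumes indep: "indep_vars (\<lambda>_. borel) X {1..}"
    and distr: "\<And>i. 1 \<le> i \<Longrightarrow> distr M borel (X i) = distr M borel (X 1)"
    and int: "integrable M (X 1)" and neg: "expectation (X 1) < 0"
    and s0: "0 < s0" "integrable M (\<lambda>\<omega>. exp (s0 * X 1 \<omega>))"
  obtains \<sigma> :: real where "1 < \<sigma>"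
    "AE \<omega> in M. \<exists>n0. \<forall>n\<ge>n0. \<forall>N. real N \<le> \<sigma> ^ n \<longrightarrow> (\<Sum>i=N+1..N+n. X i \<omega>) < 0"
proof -
  have meas [measurable]: "X i \<in> borel_measurable M" if "1 \<le> i" for i
    using indep that by (auto simp: indep_vars_def)
  obtain s where s: "0 < s" "integrable M (\<lambda>\<omega>. exp (s * X 1 \<omega>))"
    and less_1: "expectation (\<lambda>\<omega>. exp (s * X 1 \<omega>)) < 1"
    using exp_moment_less_1[OF int neg s0] .
  define \<rho> where "\<rho> = expectation (\<lambda>\<omega>. exp (s * X 1 \<omega>))"
  have \<rho>: "0 \<le> \<rho>" "\<rho> < 1"
    using less_1 by (auto simp: \<rho>_def intro!: integral_nonneg_AE)
  have moment: "(\<integral>\<^sup>+\<omega>. ennreal (exp (s * X i \<omega>)) \<partial>M) = ennreal \<rho>" if "1 \<le> i" for i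
  proof -
    have "(\<integral>\<^sup>+\<omega>. ennreal (exp (s * X i \<omega>)) \<partial>M) = (\<integral>\<^sup>+x. ennreal (exp (s * x)) \<partial>distr M borel (X i))"
      using that by (subst nn_integral_distr) auto
    also have "\<dots> = (\<integral>\<^sup>+\<omega>. ennreal (exp (s * X 1 \<omega>)) \<partial>M)"
      unfolding distr[OF that] by (subst nn_integral_distr) auto
    also have "\<dots> = ennreal \<rho>"
      unfolding \<rho>_def using s by (intro nn_integral_eq_integral) auto
    finally show ?thesis .
  qed
  obtain \<sigma> where \<sigma>: "1 < \<sigma>" "\<sigma> * \<rho> < 1"
  proof (cases "\<rho> = 0")
    case False
    then have "1 < 1 / \<rho>" using \<rho> by simp
    then obtain \<sigma> where "1 < \<sigma>" "\<sigma> < 1 / \<rho>" using dense by blast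
    then show ?thesis using that[of \<sigma>] \<rho> False by (simp add: field_simps)
  qed (use that[of 2] in simp)
  define E where "E N n = {\<omega>\<in>space M. 0 \<le> (\<Sum>i=N+1..N+n. X i \<omega>)}" for N n
  define I where "I n = {N. real N \<le> \<sigma> ^ n}" for n
  define F where "F n = (\<Union>N\<in>I n. E N n)" for n
  have I_eq: "I n = {..nat \<lfloor>\<sigma> ^ n\<rfloor>}" for n
    using \<sigma>(1) by (auto simp: I_def le_nat_floor) (simp add: le_nat_iff le_floor_iff)
  have finI: "finite (I n)" and cardI: "real (card (I n)) \<le> \<sigma> ^ n + 1" for n
    using \<sigma>(1) by (auto simp: I_eq intro: of_nat_floor)
  have E_meas [measurable]: "E N n \<in> events" for N n
  proof -
    have [measurable]: "X i \<in> borel_measurable M" if "i \<in> {N + 1..N + n}" for i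
      using that meas by auto
    show ?thesis unfolding E_def by measurable
  qed
  have E_le: "prob (E N n) \<le> \<rho> ^ n" for N n
  proof -
    have "prob (E N n) \<le> \<rho> ^ card {N + 1..N + n}"
      unfolding E_def using moment s(1) \<rho>
      by (intro chernoff_bound[where s=s] indep_vars_subset[OF indep]) auto
    then show ?thesis by simp
  qed
  have F_meas: "F n \<in> events" for n
    unfolding F_def using finI by auto
  have F_le: "prob (F n) \<le> (\<sigma> * \<rho>) ^ n + \<rho> ^ n" for n
  proof -
    have "prob (F n) \<le> (\<Sum>N\<in>I n. prob (E N n))"
      unfolding F_def using finI by (intro finite_measure_subadditive_finite) auto
    also have "\<dots> \<le> (\<Sum>N\<in>I n. \<rho> ^ n)" by (intro sum_mono E_le)
    also have "\<dots> \<le> (\<sigma> ^ n + 1) * \<rho> ^ n" using cardI[of n] \<rho> by (auto intro: mult_right_mono)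
    finally show ?thesis by (simp add: algebra_simps power_mult_distrib)
  qed
  have "summable (\<lambda>n. prob (F n))"
  proof (rule summable_comparison_test')
    show "summable (\<lambda>n. (\<sigma> * \<rho>) ^ n + \<rho> ^ n)"
      using \<sigma> \<rho> by (intro summable_add summable_geometric) (simp_all add: abs_mult)
    show "norm (prob (F n)) \<le> (\<sigma> * \<rho>) ^ n + \<rho> ^ n" for n
      using F_le[of n] by simp
  qed
  then have "AE \<omega> in M. eventually (\<lambda>n. \<omega> \<in> space M - F n) sequentially"
    by (intro borel_cantelli_AE1 F_meas) (auto simp: emeasure_eq_measure)
  then have "AE \<omega> in M. \<exists>n0. \<forall>n\<ge>n0. \<forall>N. real N \<le> \<sigma> ^ n \<longrightarrow> (\<Sum>i=N+1..N+n. X i \<omega>) < 0"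
  proof (eventually_elim)
    case (elim \<omega>)
    then obtain n0 where n0: "\<And>n. n0 \<le> n \<Longrightarrow> \<omega> \<in> space M \<and> \<omega> \<notin> F n"
      unfolding eventually_sequentially by blast
    have "(\<Sum>i=N+1..N+n. X i \<omega>) < 0" if "n0 \<le> n" "real N \<le> \<sigma> ^ n" for n N
    proof -
      have "\<omega> \<notin> E N n" using n0[OF that(1)] that(2) unfolding F_def I_def by blast
      then show ?thesis using n0[OF that(1)] unfolding E_def by simp
    qed
    then show ?case by blast
  qed
  then show ?thesis using that \<sigma>(1) by blast
qed

end

section \<open>Deterministic bounds for the upper dimension\<close>

text \<open>
  Whatever child is chosen, the loss of mass compared with the \<open>d\<close>-th power of the length is at most
  the loss under the rule that defines \<open>Y(d)\<close> and \<open>Z(d)\<close>, because \<open>z \<le> c(d)\<close> holds exactly when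
  \<open>z / x^d \<le> (1 - z) / y^d\<close>.
\<close>

lemma greedy_choice_worst:
  fixes x y z d :: real
  assumes "0 < x" "0 < y" "0 < z" "z < 1"
  shows "d * ln (if c then x else y) - ln (if c then z else 1 - z)
    \<le> d * Z_val d x y z - Y_val d x y z"
proof -
  define u where "u = x powr d"
  define v where "v = y powr d"
  have uv: "0 < u" "0 < v" "ln u = d * ln x" "ln v = d * ln y"
    using assms by (auto simp: u_def v_def)
  have crit: "z \<le> ratio_c d x y \<longleftrightarrow> z * v \<le> (1 - z) * u"
    using uv by (simp add: ratio_c_def u_def[symmetric] v_def[symmetric] pos_le_divide_eq add_pos_pos algebra_simps)
  show ?thesis
  proof (cases "z \<le> ratio_c d x y")
    case True
    then have "ln (z * v) \<le> ln ((1 - z) * u)" using crit assms uv by (subst ln_le_cancel_iff) auto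
    then have "ln z + ln v \<le> ln (1 - z) + ln u" using assms uv by (simp add: ln_mult)
    then show ?thesis using True uv by (auto simp: Z_val_def Y_val_def)
  next
    case False
    then have "ln ((1 - z) * u) \<le> ln (z * v)" using crit assms uv by (subst ln_le_cancel_iff) auto
    then have "ln (1 - z) + ln u \<le> ln z + ln v" using assms uv by (simp add: ln_mult)
    then show ?thesis using False uv by (auto simp: Z_val_def Y_val_def)
  qed
qed

lemma filterlim_abs_at_bot: "filterlim (\<lambda>x::real. \<bar>x\<bar>) at_top at_bot"
proof -
  have "\<forall>\<^sub>F x::real in at_bot. - x = \<bar>x\<bar>"
    using eventually_le_at_bot[of "0::real"] by eventually_elim simp
  then show ?thesis using filterlim_uminus_at_top_at_bot by (rule filterlim_mono_eventually[OF _ order_refl order_refl, rotated])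
qed

text \<open>
  Here \<open>\<Phi> R |log R| = H R log |log R|\<close> is the logarithm of the guaranteed ratio \<open>R / r\<close> of the two
  scales. In the application \<open>1 + |log R| / \<beta>\<close> bounds the step \<open>N\<close> of the larger scale and \<open>\<kappa>\<close> is the
  largest possible decrease of the logarithm of the length in one step, so the two inequalities say
  that the number \<open>n\<close> of steps between the scales is at least \<open>n0\<close> and that \<open>N \<le> exp (s n)\<close>. Both
  hold because \<open>H\<close> exceeds every constant and \<open>log |log R|\<close> absorbs the additive terms.
\<close>

lemma large_dimension_function_dominates:
  fixes \<Phi> :: "real \<Rightarrow> real" and c \<kappa> \<beta> s n0 :: real
  assumes "large_dimension_function \<Phi>" and pos: "0 < \<kappa>" "0 < \<beta>" "0 < s"
  shows "\<forall>\<^sub>F R in at_right 0. \<kappa> * n0 \<le> \<Phi> R * \<bar>ln R\<bar> + c \<and>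
    \<kappa> * ln (1 + \<bar>ln R\<bar> / \<beta>) \<le> s * (\<Phi> R * \<bar>ln R\<bar> + c)"
proof -
  obtain H where H: "filterlim H at_top (at_right 0)"
    and eq: "\<forall>\<^sub>F t in at_right 0. \<Phi> t = H t * (ln \<bar>ln t\<bar> / \<bar>ln t\<bar>)"
    using assms(1) by (auto simp: large_dimension_function_def)
  define C where "C = ln (1 + 1 / \<beta>)"
  have L: "filterlim (\<lambda>R::real. \<bar>ln R\<bar>) at_top (at_right 0)"
    by (rule filterlim_compose[OF filterlim_abs_at_bot ln_at_0])
  have U: "filterlim (\<lambda>R::real. ln \<bar>ln R\<bar>) at_top (at_right 0)"
    by (rule filterlim_compose[OF ln_at_top L])
  have "\<forall>\<^sub>F R in at_right 0. \<kappa> / s + 1 \<le> H R" "\<forall>\<^sub>F R::real in at_right 0. 1 \<le> \<bar>ln R\<bar>"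
    "\<forall>\<^sub>F R::real in at_right 0. \<bar>\<kappa> * n0 - c\<bar> + \<bar>\<kappa> / s * C - c\<bar> \<le> ln \<bar>ln R\<bar>"
    using H L U by (auto simp: filterlim_at_top)
  then show ?thesis using eq
  proof eventually_elim
    case (elim R)
    define u where "u = ln \<bar>ln R\<bar>"
    have u: "\<bar>\<kappa> * n0 - c\<bar> + \<bar>\<kappa> / s * C - c\<bar> \<le> u" using elim by (simp add: u_def)
    then have u0: "0 \<le> u" by linarith
    have \<Phi>: "\<Phi> R * \<bar>ln R\<bar> = H R * u" using elim by (simp add: u_def)
    have "(\<kappa> / s + 1) * u \<le> H R * u" using elim u0 by (intro mult_right_mono) auto
    then have Hu: "\<kappa> / s * u + u \<le> H R * u" by (simp add: algebra_simps)
    have "0 \<le> \<kappa> / s * u" using pos u0 by simp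
    then have 1: "\<kappa> * n0 \<le> H R * u + c" using Hu u by linarith
    have "1 + \<bar>ln R\<bar> / \<beta> \<le> \<bar>ln R\<bar> * (1 + 1 / \<beta>)"
      using elim pos by (simp add: field_simps)
    then have "ln (1 + \<bar>ln R\<bar> / \<beta>) \<le> ln (\<bar>ln R\<bar> * (1 + 1 / \<beta>))"
      using pos elim by (subst ln_le_cancel_iff) (auto intro!: add_pos_nonneg mult_pos_pos)
    also have "\<dots> = u + C"
      unfolding u_def C_def using elim pos by (subst ln_mult) (auto simp: add_pos_pos less_imp_neq[THEN not_sym])
    finally have "\<kappa> / s * ln (1 + \<bar>ln R\<bar> / \<beta>) \<le> \<kappa> / s * (u + C)"
      using pos by (intro mult_left_mono) auto
    also have "\<dots> = \<kappa> / s * u + \<kappa> / s * C" by (simp add: distrib_left)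
    also have "\<dots> \<le> H R * u + c" using Hu u by linarith
    finally have "s * (\<kappa> / s * ln (1 + \<bar>ln R\<bar> / \<beta>)) \<le> s * (H R * u + c)"
      using pos by (intro mult_left_mono) auto
    then show ?case using 1 pos unfolding \<Phi> by simp
  qed
qed

context moran_system
begin

declare path_ivl.simps(2) [simp del]

text \<open>
  The left side of the assumption bounds the corresponding sum along every path between the steps
  \<open>N\<close> and \<open>N + n\<close>, since it uses the worst choice at each step.
\<close>

lemma mass_ratio_le:
  assumes sum: "(\<Sum>i=N+1..N+n. d * Z_val d (a i) (b i) (p i) - Y_val d (a i) (b i) (p i)) \<le> 0"
  shows "mass w N / mass w (N + n) \<le> (len w N / len w (N + n)) powr d"
proof -
  have split: "(\<Sum>i=1..N+n. f i) = (\<Sum>i=1..N. f i) + (\<Sum>i=N+1..N+n. f i)" for f :: "nat \<Rightarrow> real"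
    by (rule sum.ub_add_nat) simp
  have "(\<Sum>i=N+1..N+n. d * ln (if w i then a i else b i) - ln (if w i then p i else 1 - p i))
      \<le> (\<Sum>i=N+1..N+n. d * Z_val d (a i) (b i) (p i) - Y_val d (a i) (b i) (p i))"
    using weights less_le_trans[OF A_pos ratios(1)] less_le_trans[OF A_pos ratios(2)]
    by (intro sum_mono greedy_choice_worst) auto
  then have "ln (mass w N) - ln (mass w (N + n)) \<le> d * (ln (len w N) - ln (len w (N + n)))"
    using sum unfolding ln_mass ln_len split by (simp add: sum_subtractf sum_distrib_left[symmetric] algebra_simps)
  then have "ln (mass w N / mass w (N + n)) \<le> ln ((len w N / len w (N + n)) powr d)"
    by (simp add: ln_div less_imp_neq[OF mass_pos, THEN not_sym] less_imp_neq[OF len_pos, THEN not_sym])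
  then show ?thesis
    using mass_pos[of w N] mass_pos[of w "N + n"] len_pos[of w N] len_pos[of w "N + n"]
    by (subst (asm) ln_le_cancel_iff) simp_all
qed

lemma comparable_scale:
  assumes "0 < r" "r \<le> 1"
  obtains n where "1 \<le> n" "len w n < r" "r \<le> len w (n - 1)"
proof -
  define n where "n = (LEAST n. len w n < r)"
  have "\<exists>n. len w n < r"
    using order_tendstoD(2)[OF len_tendsto_0 \<open>0 < r\<close>] by (auto simp: eventually_sequentially)
  then have n: "len w n < r" unfolding n_def by (rule LeastI_ex)
  have "n \<noteq> 0" using n assms(2) len_0[of w] by (cases n) auto
  moreover have "r \<le> len w (n - 1)"
    using not_less_Least[of "n - 1" "\<lambda>n. len w n < r"] \<open>n \<noteq> 0\<close> by (simp add: n_def[symmetric])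
  ultimately show ?thesis using n by (intro that[of n]) auto
qed

text \<open>
  A ball of radius \<open>R\<close> is compared with a Moran interval of step \<open>N\<close> that is isolated at distance
  \<open>R\<close>, and a ball of radius \<open>r\<close> with an interval of step \<open>k = N + n\<close> that it contains; both have
  length comparable to the radius. The size of \<open>R / r\<close> then forces \<open>n \<ge> n0\<close> and \<open>N \<le> \<sigma>^n\<close>.
\<close>

lemma upper_dim_le:
  assumes large: "large_dimension_function \<Phi>" and "0 \<le> d" and "1 < \<sigma>"
    and blocks: "\<And>n N. n0 \<le> n \<Longrightarrow> real N \<le> \<sigma> ^ n \<Longrightarrow>
      (\<Sum>i=N+1..N+n. d * Z_val d (a i) (b i) (p i) - Y_val d (a i) (b i) (p i)) \<le> 0"
  shows "upper_dim \<Phi> m \<le> ereal d"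
proof -
  have "A < 1" using ratios[of 1] A_pos B_less_1 by simp
  have pos: "0 < - ln A" "0 < - ln B" "0 < ln \<sigma>"
    using \<open>A < 1\<close> A_pos B_less_1 B_pos \<open>1 < \<sigma>\<close> by (auto simp: ln_less_zero_iff)
  define c where "c = ln (A / (1 - B))"
  obtain \<epsilon> where "0 < \<epsilon>" and \<epsilon>: "\<And>R. 0 < R \<Longrightarrow> R < \<epsilon> \<Longrightarrow>
      - ln A * n0 \<le> \<Phi> R * \<bar>ln R\<bar> + c \<and>
      - ln A * ln (1 + \<bar>ln R\<bar> / - ln B) \<le> ln \<sigma> * (\<Phi> R * \<bar>ln R\<bar> + c)"
    using large_dimension_function_dominates[OF large pos, of "real n0" c] unfolding eventually_at_right_field by auto
  define C1 where "C1 = min (\<epsilon> / 2) ((1 - B) / 2)"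
  have C1: "0 < C1" "C1 < \<epsilon>" "C1 < 1 - B" "C1 < 1"
    using \<open>0 < \<epsilon>\<close> B_less_1 B_pos unfolding C1_def min_def by (auto split: if_splits)
  have "measure m (ball x R) / measure m (ball x r) \<le> (1 / ((1 - B) * A)) powr d * (R / r) powr d"
    (is "_ \<le> ?C2 * _")
    if x: "x \<in> measure_support m" and r: "0 < r" "r < R powr (1 + \<Phi> R)" and R: "R powr (1 + \<Phi> R) \<le> R" "R \<le> C1"
    for x r R
  proof -
    have R01: "0 < R" "r < R" "R < 1" using r R C1 by auto
    obtain w where w: "\<And>n. x \<in> ivl (ivl_at w n)" using support_imp_path[OF x] by metis
    \<comment> \<open>The first step at which the gap inside the interval around \<open>x\<close> may drop below \<open>R\<close>; the
      gap that separates this interval from the rest of the Moran set is still at least \<open>R\<close>.\<close>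
    obtain N where N: "1 \<le> N" "len w N < R / (1 - B)" "R / (1 - B) \<le> len w (N - 1)"
      using comparable_scale[of "R / (1 - B)"] R01 R C1 B_less_1 by (auto simp: field_simps)
    obtain k where k: "1 \<le> k" "len w k < r" "r \<le> len w (k - 1)"
      using comparable_scale[of r] R01 r C1 by auto
    have R_le: "R \<le> R / (1 - B)" using R01 B_less_1 B_pos by (simp add: field_simps)
    have "N \<le> k"
    proof (rule ccontr)
      assume "\<not> N \<le> k"
      then have "len w (N - 1) \<le> len w k" by (intro len_antimono) auto
      then show False using R_le N k R01 by linarith
    qed
    then obtain n where n: "k = N + n" using le_Suc_ex by blast
    \<comment> \<open>Lengths shrink at most by the factor \<open>A\<close> in each step, so many steps lie between
      the two scales.\<close>
    have lenN: "R * (A / (1 - B)) \<le> len w N"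
      using len_Suc(1)[of w "N - 1"] N mult_left_mono[OF N(3), of A] A_pos by (simp add: algebra_simps)
    have "A ^ n * (R * (A / (1 - B))) \<le> A ^ n * len w N"
      using lenN A_pos by (intro mult_left_mono) auto
    also have "\<dots> < r" using len_ge_power[of n w N] k n by simp
    finally have "ln (A ^ n * (R * (A / (1 - B)))) < ln r"
      using R01 r A_pos B_less_1 by (subst ln_less_cancel_iff) auto
    moreover have "ln (A ^ n * (R * (A / (1 - B)))) = n * ln A + (ln R + c)"
    proof -
      have ln3: "ln (x * (y * z)) = ln x + (ln y + ln z)" if "0 < x" "0 < y" "0 < z" for x y z :: real
        using that by (simp add: ln_mult)
      have "ln (A ^ n * (R * (A / (1 - B)))) = ln (A ^ n) + (ln R + ln (A / (1 - B)))"
        by (rule ln3) (use R01 A_pos B_less_1 in simp_all)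
      then show ?thesis unfolding c_def ln_realpow .
    qed
    ultimately have "n * ln A + ln R + c < ln r" by simp
    moreover have "ln r < ln (R powr (1 + \<Phi> R))"
      using r R01 by (subst ln_less_cancel_iff) auto
    ultimately have n_large: "\<Phi> R * \<bar>ln R\<bar> + c \<le> n * - ln A"
      using R01 by (simp add: algebra_simps)
    have "R < \<epsilon>" using R C1 by simp
    note \<epsilon>R = \<epsilon>[OF R01(1) this]
    have "- ln A * n0 \<le> - ln A * n" using \<epsilon>R n_large by (simp add: mult_ac)
    then have "n0 \<le> n" using pos by (subst (asm) mult_le_cancel_left_pos) auto
    \<comment> \<open>Lengths shrink at least by the factor \<open>B\<close> in each step, so \<open>N\<close> is at most of the order
      of \<open>|log R|\<close>.\<close>
    have "R \<le> B ^ (N - 1)"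
      using R_le N(3) len_le_power[of w "N - 1"] by linarith
    then have "ln R \<le> ln (B ^ (N - 1))" using R01 B_pos by (subst ln_le_cancel_iff) auto
    then have "real (N - 1) * - ln B \<le> \<bar>ln R\<bar>"
      using R01 B_pos by (simp add: ln_realpow)
    then have "real (N - 1) \<le> \<bar>ln R\<bar> / - ln B"
      using pos by (subst pos_le_divide_eq) auto
    then have N_le: "real N \<le> 1 + \<bar>ln R\<bar> / - ln B" using N(1) by (simp add: of_nat_diff)
    have "- ln A * ln N \<le> - ln A * ln (1 + \<bar>ln R\<bar> / - ln B)"
      using N_le N(1) pos by (intro mult_left_mono) auto
    also have "\<dots> \<le> ln \<sigma> * (\<Phi> R * \<bar>ln R\<bar> + c)" using \<epsilon>R by simp
    also have "\<dots> \<le> ln \<sigma> * (n * - ln A)" using n_large pos by (intro mult_left_mono) auto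
    finally have "- ln A * ln N \<le> - ln A * (n * ln \<sigma>)" by (simp add: mult_ac)
    then have "ln N \<le> n * ln \<sigma>" using pos by (subst (asm) mult_le_cancel_left_pos) auto
    then have "ln N \<le> ln (\<sigma> ^ n)" using \<open>1 < \<sigma>\<close> by (simp add: ln_realpow)
    then have "real N \<le> \<sigma> ^ n" using \<open>1 < \<sigma>\<close> N(1) by (subst (asm) ln_le_cancel_iff) auto
    with blocks \<open>n0 \<le> n\<close> have mr: "mass w N / mass w k \<le> (len w N / len w k) powr d"
      unfolding n by (intro mass_ratio_le) auto
    have "measure m (ball x R) / measure m (ball x r) \<le> mass w N / mass w k"
      using ball_le_mass[OF w, of R N] ivl_subset_ball[OF w k(2)] N B_less_1 mass_pos[of w k]
      by (intro frac_le) (auto simp: field_simps)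
    also note mr
    also have "(len w N / len w k) powr d \<le> (1 / ((1 - B) * A) * (R / r)) powr d"
    proof (rule powr_mono2[OF \<open>0 \<le> d\<close>])
      have "A * r \<le> len w k"
        using order_trans[OF mult_left_mono[OF k(3), of A] len_Suc(1)[of w "k - 1"]] k(1) A_pos by simp
      then have "len w N / len w k \<le> (R / (1 - B)) / (A * r)"
        using less_imp_le[OF N(2)] less_imp_le[OF divide_pos_pos[of R "1 - B"]] mult_pos_pos[OF A_pos r(1)]
          R01(1) B_less_1
        by (intro frac_le) simp_all
      then show "len w N / len w k \<le> 1 / ((1 - B) * A) * (R / r)" by (simp add: mult_ac)
      show "0 \<le> len w N / len w k" using len_pos[of w N] len_pos[of w k] by simp
    qed
    also have "\<dots> = (1 / ((1 - B) * A)) powr d * (R / r) powr d"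
      by (rule powr_mult)
    finally show ?thesis .
  qed
  note bound = this
  have "0 < ?C2" using A_pos B_less_1 by simp
  show ?thesis
    unfolding upper_dim_def
  proof (rule Inf_lower, rule CollectI, intro exI conjI)
    show "\<forall>x\<in>measure_support m. \<forall>r R. 0 < r \<and> r < R powr (1 + \<Phi> R) \<and>
        R powr (1 + \<Phi> R) \<le> R \<and> R \<le> C1 \<longrightarrow>
        measure m (ball x R) / measure m (ball x r) \<le> ?C2 * (R / r) powr d"
      by (intro ballI allI impI, elim conjE) (rule bound)
  qed (use \<open>0 < ?C2\<close> C1 in simp_all)
qed

text \<open>
  Along the path \<open>w\<close> that realises \<open>Y(\<alpha>)\<close> and \<open>Z(\<alpha>)\<close>, the mass of the \<open>n\<close>-th interval is
  exponentially small compared with the \<open>d\<close>-th power of its length. If an exponent \<open>e < d\<close> were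
  admissible, then at the limit point of \<open>w\<close>, with the large radius fixed and the small radius
  shrinking to \<open>0\<close>, the mass of the large ball would be at most a constant times \<open>exp (- \<delta> n)\<close>.
\<close>

lemma upper_dim_ge:
  assumes nonneg: "\<And>t. 0 < t \<Longrightarrow> t < 1 \<Longrightarrow> 0 \<le> \<Phi> t" and "0 < \<delta>"
    and sums: "\<And>n. n0 \<le> n \<Longrightarrow>
      (\<Sum>i=1..n. Y_val \<alpha> (a i) (b i) (p i) - d * Z_val \<alpha> (a i) (b i) (p i) + \<delta>) \<le> 0"
  shows "ereal d \<le> upper_dim \<Phi> m"
proof -
  define w where "w i \<longleftrightarrow> p i \<le> ratio_c \<alpha> (a i) (b i)" for i
  have small: "mass w n \<le> len w n powr d * exp (- \<delta> * n)" if "n0 \<le> n" for n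
  proof -
    have "ln (mass w n) = (\<Sum>i=1..n. Y_val \<alpha> (a i) (b i) (p i))"
      unfolding ln_mass by (intro sum.cong) (auto simp: w_def Y_val_def)
    moreover have "ln (len w n) = (\<Sum>i=1..n. Z_val \<alpha> (a i) (b i) (p i))"
      unfolding ln_len by (intro sum.cong) (auto simp: w_def Z_val_def)
    ultimately have "ln (mass w n) - d * ln (len w n) + \<delta> * n \<le> 0"
      using sums[OF that] by (simp add: sum.distrib sum_subtractf sum_distrib_left mult_ac)
    then have "ln (mass w n) \<le> ln (len w n powr d * exp (- \<delta> * n))"
      using len_pos[of w n] by (simp add: ln_mult)
    then show ?thesis
      using mass_pos[of w n] len_pos[of w n] by (subst (asm) ln_le_cancel_iff) auto
  qed
  obtain x where x: "\<And>n. x \<in> ivl (ivl_at w n)" using path_has_limit[of w] by metis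
  have x_supp: "x \<in> measure_support m" using path_imp_support[OF x] .
  then have ball_pos: "0 < measure m (ball x r)" if "0 < r" for r
    using that by (auto simp: measure_support_def emeasure_eq_measure)
  have "d \<le> e"
    if C: "0 < C1" "0 < C2" "C1 < 1"
      and adm: "\<And>r R. 0 < r \<Longrightarrow> r < R powr (1 + \<Phi> R) \<Longrightarrow> R powr (1 + \<Phi> R) \<le> R \<Longrightarrow> R \<le> C1 \<Longrightarrow>
        measure m (ball x R) / measure m (ball x r) \<le> C2 * (R / r) powr e"
    for C1 C2 e
  proof (rule ccontr)
    assume "\<not> d \<le> e"
    define S where "S = C1 powr (1 + \<Phi> C1)"
    have S: "0 < S" "S \<le> C1"
      using C nonneg[of C1] powr_mono'[of 1 "1 + \<Phi> C1" C1] by (auto simp: S_def)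
    define K where "K = max ((A / (1 - B)) powr e) ((B / (1 - B)) powr e)"
    define D where "D = C2 * C1 powr e * K"
    \<comment> \<open>The large radius is \<open>C1\<close> throughout; the small one is a lower bound for the gap inside
      the interval of step \<open>k\<close>, which isolates the interval of step \<open>k + 1\<close>.\<close>
    have bound: "measure m (ball x C1) \<le> D * exp (- \<delta> * Suc k)"
      if k: "n0 \<le> k" "(1 - B) * len w k < S" for k
    proof -
      define r where "r = (1 - B) * len w k"
      \<comment> \<open>The quotient of length and radius is bounded on both sides, which covers exponents
        \<open>e\<close> of either sign.\<close>
      define q where "q = len w (Suc k) / r"
      have r: "0 < r" "r < S" using k B_less_1 len_pos[of w k] by (auto simp: r_def)
      have q: "A / (1 - B) \<le> q" "q \<le> B / (1 - B)"
      proof -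
        have "A \<le> len w (Suc k) / len w k" "len w (Suc k) / len w k \<le> B"
          using len_Suc[of w k] by (simp_all only: pos_le_divide_eq[OF len_pos] pos_divide_le_eq[OF len_pos])
        moreover have "q = len w (Suc k) / len w k / (1 - B)"
          by (simp only: q_def r_def divide_divide_eq_left mult.commute)
        ultimately show "A / (1 - B) \<le> q" "q \<le> B / (1 - B)"
          using B_less_1 by (simp_all only: divide_right_mono diff_ge_0_iff_ge less_imp_le)
      qed
      have q0: "0 < q" using len_pos[of w "Suc k"] r by (simp add: q_def)
      have qK: "q powr e \<le> K"
      proof (cases "0 \<le> e")
        case True
        then show ?thesis using q q0 powr_mono2[of e q "B / (1 - B)"] by (simp add: K_def)
      next
        case False
        then have "q powr e \<le> (A / (1 - B)) powr e"
          using q A_pos B_less_1 by (intro powr_mono2') auto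
        then show ?thesis by (simp add: K_def)
      qed
      have "measure m (ball x r) \<le> mass w (Suc k)"
        by (rule ball_le_mass[OF x]) (simp add: r_def)
      also have "\<dots> \<le> len w (Suc k) powr d * exp (- \<delta> * Suc k)"
        using k by (intro small) auto
      also have "\<dots> \<le> len w (Suc k) powr e * exp (- \<delta> * Suc k)"
        using \<open>\<not> d \<le> e\<close> len_pos[of w "Suc k"] len_antimono[of 0 "Suc k" w] len_0[of w]
        by (intro mult_right_mono powr_mono') auto
      finally have ball_r: "measure m (ball x r) \<le> len w (Suc k) powr e * exp (- \<delta> * Suc k)" .
      have "measure m (ball x C1) / measure m (ball x r) \<le> C2 * (C1 / r) powr e"
        using adm[of r C1] r S by (simp add: S_def)
      then have "measure m (ball x C1) \<le> C2 * (C1 / r) powr e * measure m (ball x r)"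
        using ball_pos[OF r(1)] by (simp add: pos_divide_le_eq)
      also have "\<dots> \<le> C2 * (C1 / r) powr e * (len w (Suc k) powr e * exp (- \<delta> * Suc k))"
        using ball_r C by (intro mult_left_mono) auto
      also have "\<dots> = C2 * C1 powr e * q powr e * exp (- \<delta> * Suc k)"
        by (simp only: q_def powr_divide) (simp only: divide_inverse mult_ac)
      also have "\<dots> \<le> D * exp (- \<delta> * Suc k)"
        unfolding D_def using qK C by (intro mult_right_mono mult_left_mono) auto
      finally show ?thesis .
    qed
    have "(\<lambda>k. (1 - B) * len w k) \<longlonglongrightarrow> (1 - B) * 0"
      by (intro tendsto_intros len_tendsto_0)
    then have "\<forall>\<^sub>F k in sequentially. (1 - B) * len w k < S"
      using S by (intro order_tendstoD) auto
    moreover have "(\<lambda>k. D * exp (- \<delta>) ^ Suc k) \<longlonglongrightarrow> D * 0"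
      using \<open>0 < \<delta>\<close> by (intro tendsto_mult tendsto_const LIMSEQ_Suc LIMSEQ_power_zero) auto
    then have "\<forall>\<^sub>F k in sequentially. D * exp (- \<delta>) ^ Suc k < measure m (ball x C1)"
      using ball_pos C by (intro order_tendstoD) auto
    moreover have "\<forall>\<^sub>F k in sequentially. n0 \<le> k" by (rule eventually_ge_at_top)
    ultimately have "\<forall>\<^sub>F k in sequentially. False"
    proof eventually_elim
      case (elim k)
      have "exp (- \<delta>) ^ Suc k = exp (- \<delta> * Suc k)"
        by (simp add: exp_of_nat_mult[symmetric] mult_ac del: power_Suc)
      then show False using bound[of k] elim by simp
    qed
    then show False by simp
  qed
  note adm_imp_le = this
  show ?thesis
    unfolding upper_dim_def
  proof (rule Inf_greatest, clarify)
    fix e C1 C2 :: real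
    assume C: "0 < C1" "0 < C2" "C1 < 1"
      and adm: "\<forall>x\<in>measure_support m. \<forall>r R. 0 < r \<and> r < R powr (1 + \<Phi> R) \<and>
        R powr (1 + \<Phi> R) \<le> R \<and> R \<le> C1 \<longrightarrow>
        measure m (ball x R) / measure m (ball x r) \<le> C2 * (R / r) powr e"
    have "d \<le> e"
      by (rule adm_imp_le[OF C]) (intro adm[rule_format] x_supp conjI)
    then show "ereal d \<le> ereal e" by simp
  qed
qed

end

section \<open>Random parameters\<close>

lemma measurable_Y_val [measurable]:
  "(\<lambda>(x, y, z). Y_val \<theta> x y z) \<in> borel_measurable borel"
  unfolding Y_val_def ratio_c_def by (simp add: borel_prod[symmetric])

lemma measurable_Z_val [measurable]:
  "(\<lambda>(x, y, z). Z_val \<theta> x y z) \<in> borel_measurable borel"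
  unfolding Z_val_def ratio_c_def by (simp add: borel_prod[symmetric])

lemma Z_val_bounds:
  assumes "0 < A" "A \<le> x" "A \<le> y" "x + y \<le> B" "B < 1"
  shows "ln A \<le> Z_val \<theta> x y z" "Z_val \<theta> x y z \<le> ln B" "ln B < 0"
  using assms by (auto simp: Z_val_def)

lemma Y_val_nonpos:
  assumes "0 \<le> z" "z \<le> 1"
  shows "Y_val \<theta> x y z \<le> 0"
  using assms by (cases "z = 0 \<or> z = 1") (auto simp: Y_val_def)

text \<open>
  The value of \<open>exp (- t Y)\<close> is one of the two inverse powers. If it is the one with base \<open>0\<close>, the
  right side is infinite.
\<close>

lemma exp_Y_val_le:
  assumes "0 \<le> z" "z \<le> 1"
  shows "ennreal (exp (- t * Y_val \<theta> x y z)) \<le>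
    inverse (ennreal (z powr t)) + inverse (ennreal ((1 - z) powr t))"
proof -
  have *: "ennreal (exp (- t * ln u)) \<le> inverse (ennreal (u powr t))" if "0 \<le> u" for u :: real
    using that by (cases "u = 0") (auto simp: powr_def exp_minus inverse_ennreal)
  show ?thesis
    using *[of z] *[of "1 - z"] assms
    by (auto simp: Y_val_def intro: order_trans[OF _ le_add1] order_trans[OF _ add_increasing] add_increasing add_increasing2)
qed

locale random_moran = prob_space M for M :: "'w measure" +
  fixes A B :: real and a b p :: "nat \<Rightarrow> 'w \<Rightarrow> real"
  assumes params: "random_moran_parameters M A B a b p"
begin

abbreviation params_at :: "nat \<Rightarrow> 'w \<Rightarrow> real \<times> real \<times> real" where
  "params_at n \<omega> \<equiv> (a n \<omega>, b n \<omega>, p n \<omega>)"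

abbreviation Y :: "real \<Rightarrow> 'w \<Rightarrow> real" where
  "Y \<theta> \<omega> \<equiv> Y_val \<theta> (a 1 \<omega>) (b 1 \<omega>) (p 1 \<omega>)"

abbreviation Z :: "real \<Rightarrow> 'w \<Rightarrow> real" where
  "Z \<theta> \<omega> \<equiv> Z_val \<theta> (a 1 \<omega>) (b 1 \<omega>) (p 1 \<omega>)"

lemma A_B: "0 < A" "B < 1"
  using params unfolding random_moran_parameters_def by linarith+

lemma indep_params: "indep_vars (\<lambda>_. borel) params_at {1..}"
  using params unfolding random_moran_parameters_def by blast

lemma params_range:
  assumes "\<omega> \<in> space M" "1 \<le> n"
  shows "A \<le> a n \<omega>" "A \<le> b n \<omega>" "a n \<omega> + b n \<omega> \<le> B" "0 \<le> p n \<omega>" "p n \<omega> \<le> 1"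
proof -
  have "\<forall>n\<ge>1. \<forall>\<omega>\<in>space M.
      a n \<omega> \<in> {0..1} \<and> b n \<omega> \<in> {0..1} \<and> p n \<omega> \<in> {0..1} \<and>
      A \<le> min (a n \<omega>) (b n \<omega>) \<and> min (a n \<omega>) (b n \<omega>) < a n \<omega> + b n \<omega> \<and> a n \<omega> + b n \<omega> \<le> B"
    using params unfolding random_moran_parameters_def by blast
  then show "A \<le> a n \<omega>" "A \<le> b n \<omega>" "a n \<omega> + b n \<omega> \<le> B" "0 \<le> p n \<omega>" "p n \<omega> \<le> 1"
    using assms by auto
qed

lemma measurable_params: "1 \<le> n \<Longrightarrow> params_at n \<in> borel_measurable M"
  using indep_params by (auto simp: indep_vars_def)

lemma measurable_p: "1 \<le> n \<Longrightarrow> p n \<in> borel_measurable M"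
  using measurable_compose[OF measurable_params, of n "\<lambda>t. snd (snd t)" borel]
  by (simp add: borel_prod[symmetric])

lemma measurable_Y [measurable]: "Y \<theta> \<in> borel_measurable M"
  and measurable_Z [measurable]: "Z \<theta> \<in> borel_measurable M"
  using measurable_compose[OF measurable_params measurable_Y_val, of 1 \<theta>]
    measurable_compose[OF measurable_params measurable_Z_val, of 1 \<theta>] by simp_all

lemma weights_AE: "AE \<omega> in M. \<forall>n\<ge>1. 0 < p n \<omega> \<and> p n \<omega> < 1"
proof -
  obtain t where "0 < t" and t: "\<And>n. 1 \<le> n \<Longrightarrow> (\<integral>\<^sup>+\<omega>. inverse (ennreal (p n \<omega> powr t)) \<partial>M) < \<infinity>"
      "\<And>n. 1 \<le> n \<Longrightarrow> (\<integral>\<^sup>+\<omega>. inverse (ennreal ((1 - p n \<omega>) powr t)) \<partial>M) < \<infinity>"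
    using params unfolding random_moran_parameters_def by blast
  have "AE \<omega> in M. 0 < p n \<omega> \<and> p n \<omega> < 1" if n: "1 \<le> n" for n
  proof -
    have [measurable]: "p n \<in> borel_measurable M" using measurable_p[OF n] .
    have "AE \<omega> in M. inverse (ennreal (p n \<omega> powr t)) \<noteq> \<infinity>"
      using t(1)[OF n] by (intro nn_integral_PInf_AE) auto
    moreover have "AE \<omega> in M. inverse (ennreal ((1 - p n \<omega>) powr t)) \<noteq> \<infinity>"
      using t(2)[OF n] by (intro nn_integral_PInf_AE) auto
    ultimately show ?thesis using AE_space
    proof eventually_elim
      case (elim \<omega>)
      then have "p n \<omega> \<noteq> 0" "p n \<omega> \<noteq> 1" by auto
      then show ?case using params_range(4,5)[OF elim(3) n] by simp
    qed
  qed
  then show ?thesis by (simp add: AE_all_countable)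
qed

lemma exp_moment_Y:
  obtains t where "0 < t" "\<And>\<theta>. integrable M (\<lambda>\<omega>. exp (- t * Y \<theta> \<omega>))"
proof -
  obtain t where "0 < t" and t: "(\<integral>\<^sup>+\<omega>. inverse (ennreal (p 1 \<omega> powr t)) \<partial>M) < \<infinity>"
      "(\<integral>\<^sup>+\<omega>. inverse (ennreal ((1 - p 1 \<omega>) powr t)) \<partial>M) < \<infinity>"
    using params unfolding random_moran_parameters_def by blast
  have [measurable]: "p 1 \<in> borel_measurable M" using measurable_p by simp
  have "integrable M (\<lambda>\<omega>. exp (- t * Y \<theta> \<omega>))" for \<theta>
  proof (rule integrableI_bounded)
    have "(\<integral>\<^sup>+\<omega>. ennreal (norm (exp (- t * Y \<theta> \<omega>))) \<partial>M) \<le>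
        (\<integral>\<^sup>+\<omega>. inverse (ennreal (p 1 \<omega> powr t)) + inverse (ennreal ((1 - p 1 \<omega>) powr t)) \<partial>M)"
    proof (rule nn_integral_mono)
      fix \<omega> assume "\<omega> \<in> space M"
      from exp_Y_val_le[OF params_range(4,5)[OF this, of 1]]
      show "ennreal (norm (exp (- t * Y \<theta> \<omega>))) \<le>
          inverse (ennreal (p 1 \<omega> powr t)) + inverse (ennreal ((1 - p 1 \<omega>) powr t))" by simp
    qed
    also have "\<dots> = (\<integral>\<^sup>+\<omega>. inverse (ennreal (p 1 \<omega> powr t)) \<partial>M) +
        (\<integral>\<^sup>+\<omega>. inverse (ennreal ((1 - p 1 \<omega>) powr t)) \<partial>M)"
      by (rule nn_integral_add) measurable
    also have "\<dots> < \<infinity>" using t by simp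
    finally show "(\<integral>\<^sup>+\<omega>. ennreal (norm (exp (- t * Y \<theta> \<omega>))) \<partial>M) < \<infinity>" .
  qed measurable
  with \<open>0 < t\<close> show ?thesis by (rule that)
qed

lemma Y_nonpos: "\<omega> \<in> space M \<Longrightarrow> Y \<theta> \<omega> \<le> 0"
  using params_range(4,5)[of \<omega> 1] by (intro Y_val_nonpos) auto

lemma integrable_Y: "integrable M (Y \<theta>)"
proof -
  obtain t where t: "0 < t" "integrable M (\<lambda>\<omega>. exp (- t * Y \<theta> \<omega>))"
    using exp_moment_Y by metis
  show ?thesis
  proof (rule Bochner_Integration.integrable_bound)
    show "integrable M (\<lambda>\<omega>. exp (- t * Y \<theta> \<omega>) / t)" using t by simp
    show "AE \<omega> in M. norm (Y \<theta> \<omega>) \<le> norm (exp (- t * Y \<theta> \<omega>) / t)"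
    proof (rule AE_I2)
      fix \<omega> assume "\<omega> \<in> space M"
      then have "Y \<theta> \<omega> \<le> 0" by (rule Y_nonpos)
      moreover have "- t * Y \<theta> \<omega> \<le> exp (- t * Y \<theta> \<omega>)"
        using exp_ge_add_one_self[of "- t * Y \<theta> \<omega>"] by linarith
      ultimately show "norm (Y \<theta> \<omega>) \<le> norm (exp (- t * Y \<theta> \<omega>) / t)"
        using t by (simp add: pos_le_divide_eq mult_ac)
    qed
  qed measurable
qed

lemma Z_bounds:
  assumes "\<omega> \<in> space M"
  shows "ln A \<le> Z \<theta> \<omega>" "Z \<theta> \<omega> \<le> ln B" "Z \<theta> \<omega> \<le> 0"
  using Z_val_bounds(1,2)[OF A_B(1) params_range(1,2,3)[OF assms order_refl] A_B(2), of \<theta> "p 1 \<omega>"]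
    Z_val_bounds(3)[OF A_B(1) params_range(1,2,3)[OF assms order_refl] A_B(2)]
  by linarith+

lemma integrable_Z: "integrable M (Z \<theta>)"
proof (rule integrable_const_bound)
  show "AE \<omega> in M. norm (Z \<theta> \<omega>) \<le> - ln A"
  proof (rule AE_I2)
    fix \<omega> assume "\<omega> \<in> space M"
    from Z_bounds[OF this, of \<theta>] show "norm (Z \<theta> \<omega>) \<le> - ln A" by simp
  qed
qed measurable

lemma expectation_Z_neg: "expectation (Z \<theta>) < 0"
proof -
  obtain \<omega> where "\<omega> \<in> space M" using not_empty by auto
  have "expectation (Z \<theta>) \<le> expectation (\<lambda>_. ln B)"
    using Z_bounds(2) by (intro integral_mono integrable_Z) auto
  also have "\<dots> < 0"
    using Z_val_bounds(3)[OF A_B(1) params_range(1,2,3)[OF \<open>\<omega> \<in> space M\<close> order_refl] A_B(2)] 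
    by (simp add: prob_space)
  finally show ?thesis .
qed

lemma block_sums_of_params:
  fixes f :: "real \<times> real \<times> real \<Rightarrow> real"
  assumes f [measurable]: "f \<in> borel_measurable borel"
    and "integrable M (\<lambda>\<omega>. f (params_at 1 \<omega>))" "expectation (\<lambda>\<omega>. f (params_at 1 \<omega>)) < 0"
    and "0 < s" "integrable M (\<lambda>\<omega>. exp (s * f (params_at 1 \<omega>)))"
  obtains \<sigma> :: real where "1 < \<sigma>"
    "AE \<omega> in M. \<exists>n0. \<forall>n\<ge>n0. \<forall>N. real N \<le> \<sigma> ^ n \<longrightarrow> (\<Sum>i=N+1..N+n. f (params_at i \<omega>)) < 0"
proof (rule block_sums_eventually_negative)
  show "indep_vars (\<lambda>_. borel) (\<lambda>i \<omega>. f (params_at i \<omega>)) {1..}"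
    by (rule indep_vars_compose2[OF indep_params f])
  show "distr M borel (\<lambda>\<omega>. f (params_at i \<omega>)) = distr M borel (\<lambda>\<omega>. f (params_at 1 \<omega>))"
    if i: "1 \<le> i" for i
  proof -
    have "distr M borel (\<lambda>\<omega>. f (params_at n \<omega>)) = distr (distr M borel (params_at n)) borel f"
      if "1 \<le> n" for n
      using distr_distr[OF f measurable_params[OF that]] by (simp add: comp_def)
    moreover have "distr M borel (params_at i) = distr M borel (params_at 1)"
      using params i unfolding random_moran_parameters_def by blast
    ultimately show ?thesis using i by simp
  qed
qed (use assms that in auto)

text \<open>
  For \<open>d \<ge> 0\<close> the term \<open>d Z(d)\<close> is nonpositive, so \<open>d Z(d) - Y(d)\<close> inherits the exponential
  moment of \<open>- Y(d)\<close>; its mean is \<open>E Z(d) (d - G(d))\<close>.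
\<close>

lemma blocks_above:
  assumes "0 \<le> d" and G: "G_fun M a b p d < d"
  obtains \<sigma> :: real where "1 < \<sigma>"
    "AE \<omega> in M. \<exists>n0. \<forall>n\<ge>n0. \<forall>N. real N \<le> \<sigma> ^ n \<longrightarrow>
      (\<Sum>i=N+1..N+n. d * Z_val d (a i \<omega>) (b i \<omega>) (p i \<omega>) - Y_val d (a i \<omega>) (b i \<omega>) (p i \<omega>)) < 0"
proof -
  define f where "f = (\<lambda>(x, y, z). d * Z_val d x y z - Y_val d x y z)"
  have "(\<lambda>t. d * (case t of (x, y, z) \<Rightarrow> Z_val d x y z) - (case t of (x, y, z) \<Rightarrow> Y_val d x y z))
      \<in> borel_measurable borel"
    by measurable
  then have f: "f \<in> borel_measurable borel" by (simp add: f_def case_prod_beta)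
  have mean: "expectation (\<lambda>\<omega>. d * Z d \<omega> - Y d \<omega>) < 0"
  proof -
    have "d * expectation (Z d) < expectation (Y d)"
      using G expectation_Z_neg[of d] by (simp add: G_fun_def neg_divide_less_eq)
    then show ?thesis using integrable_Y integrable_Z by simp
  qed
  obtain t where t: "0 < t" "integrable M (\<lambda>\<omega>. exp (- t * Y d \<omega>))"
    using exp_moment_Y by metis
  have int: "integrable M (\<lambda>\<omega>. exp (t * (d * Z d \<omega> - Y d \<omega>)))"
  proof (rule Bochner_Integration.integrable_bound[OF t(2)])
    show "AE \<omega> in M. norm (exp (t * (d * Z d \<omega> - Y d \<omega>))) \<le> norm (exp (- t * Y d \<omega>))"
    proof (rule AE_I2)
      fix \<omega> assume "\<omega> \<in> space M"
      then have "t * (d * Z d \<omega>) \<le> 0"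
        using Z_bounds(3)[of \<omega> d] t \<open>0 \<le> d\<close> by (simp add: mult_nonneg_nonpos)
      then show "norm (exp (t * (d * Z d \<omega> - Y d \<omega>))) \<le> norm (exp (- t * Y d \<omega>))"
        by (simp add: right_diff_distrib)
    qed
  qed measurable
  have f_eq: "f (params_at i \<omega>) = d * Z_val d (a i \<omega>) (b i \<omega>) (p i \<omega>) - Y_val d (a i \<omega>) (b i \<omega>) (p i \<omega>)"
    for i \<omega> by (simp add: f_def)
  have "integrable M (\<lambda>\<omega>. f (params_at 1 \<omega>))"
    unfolding f_eq by (intro Bochner_Integration.integrable_diff integrable_mult_right integrable_Y integrable_Z)
  then obtain \<sigma> :: real where "1 < \<sigma>"
    "AE \<omega> in M. \<exists>n0. \<forall>n\<ge>n0. \<forall>N. real N \<le> \<sigma> ^ n \<longrightarrow> (\<Sum>i=N+1..N+n. f (params_at i \<omega>)) < 0"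
    by (rule block_sums_of_params[OF f _ mean[folded f_eq] t(1) int[folded f_eq]])
  then show ?thesis unfolding f_eq by (rule that)
qed

text \<open>
  The summands have mean \<open>(\<alpha> - d) E Z(\<alpha>) + \<delta>\<close>, where \<open>\<delta>\<close> is chosen as half of the available
  margin. They are bounded above, as \<open>Y(\<alpha>)\<close> is nonpositive and \<open>Z(\<alpha>)\<close> is bounded. The blocks
  that start at \<open>N = 0\<close> suffice here.
\<close>

lemma sums_below:
  assumes G: "G_fun M a b p \<alpha> = \<alpha>" and "d < \<alpha>"
  obtains \<delta> where "0 < \<delta>"
    "AE \<omega> in M. \<exists>n0. \<forall>n\<ge>n0. 
      (\<Sum>i=1..n. Y_val \<alpha> (a i \<omega>) (b i \<omega>) (p i \<omega>) - d * Z_val \<alpha> (a i \<omega>) (b i \<omega>) (p i \<omega>) + \<delta>) < 0"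
proof -
  define \<delta> where "\<delta> = (\<alpha> - d) * - expectation (Z \<alpha>) / 2"
  have "0 < \<delta>" using \<open>d < \<alpha>\<close> expectation_Z_neg[of \<alpha>] by (simp add: \<delta>_def mult_pos_neg)
  define f where "f = (\<lambda>(x, y, z). Y_val \<alpha> x y z - d * Z_val \<alpha> x y z + \<delta>)"
  have "(\<lambda>t. (case t of (x, y, z) \<Rightarrow> Y_val \<alpha> x y z) - d * (case t of (x, y, z) \<Rightarrow> Z_val \<alpha> x y z) + \<delta>)
      \<in> borel_measurable borel"
    by measurable
  then have f: "f \<in> borel_measurable borel" by (simp add: f_def case_prod_beta)
  have mean: "expectation (\<lambda>\<omega>. Y \<alpha> \<omega> - d * Z \<alpha> \<omega> + \<delta>) < 0"
  proof -
    have "expectation (Y \<alpha>) = \<alpha> * expectation (Z \<alpha>)"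
      using G expectation_Z_neg[of \<alpha>] by (simp add: G_fun_def field_simps)
    then have "expectation (\<lambda>\<omega>. Y \<alpha> \<omega> - d * Z \<alpha> \<omega> + \<delta>) = - \<delta>"
      using integrable_Y integrable_Z by (simp add: prob_space \<delta>_def algebra_simps add_divide_distrib diff_divide_distrib)
    then show ?thesis using \<open>0 < \<delta>\<close> by simp
  qed
  have int: "integrable M (\<lambda>\<omega>. exp (1 * (Y \<alpha> \<omega> - d * Z \<alpha> \<omega> + \<delta>)))"
  proof (rule integrable_const_bound)
    show "AE \<omega> in M. norm (exp (1 * (Y \<alpha> \<omega> - d * Z \<alpha> \<omega> + \<delta>))) \<le> exp (\<bar>d\<bar> * - ln A + \<delta>)"
    proof (rule AE_I2)
      fix \<omega> assume \<omega>: "\<omega> \<in> space M"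
      have "- (d * Z \<alpha> \<omega>) \<le> \<bar>d\<bar> * \<bar>Z \<alpha> \<omega>\<bar>" by (metis abs_ge_minus_self abs_mult)
      also have "\<dots> \<le> \<bar>d\<bar> * - ln A" using Z_bounds[OF \<omega>, of \<alpha>] by (intro mult_left_mono) auto
      finally show "norm (exp (1 * (Y \<alpha> \<omega> - d * Z \<alpha> \<omega> + \<delta>))) \<le> exp (\<bar>d\<bar> * - ln A + \<delta>)"
        using Y_nonpos[OF \<omega>, of \<alpha>] by simp
    qed
  qed measurable
  have f_eq: "f (params_at i \<omega>) = Y_val \<alpha> (a i \<omega>) (b i \<omega>) (p i \<omega>) - d * Z_val \<alpha> (a i \<omega>) (b i \<omega>) (p i \<omega>) + \<delta>"
    for i \<omega> by (simp add: f_def)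
  have "integrable M (\<lambda>\<omega>. f (params_at 1 \<omega>))"
    unfolding f_eq by (intro Bochner_Integration.integrable_add Bochner_Integration.integrable_diff
        integrable_mult_right integrable_Y integrable_Z integrable_const)
  then obtain \<sigma> :: real where "1 < \<sigma>" and
    blocks: "AE \<omega> in M. \<exists>n0. \<forall>n\<ge>n0. \<forall>N. real N \<le> \<sigma> ^ n \<longrightarrow> (\<Sum>i=N+1..N+n. f (params_at i \<omega>)) < 0"
    by (rule block_sums_of_params[OF f _ mean[folded f_eq] zero_less_one int[folded f_eq]])
  have "AE \<omega> in M. \<exists>n0. \<forall>n\<ge>n0. (\<Sum>i=1..n. f (params_at i \<omega>)) < 0"
    using blocks
  proof eventually_elim
    case (elim \<omega>)
    then obtain n0 where n0: "\<And>n N. n0 \<le> n \<Longrightarrow> real N \<le> \<sigma> ^ n \<Longrightarrow> (\<Sum>i=N+1..N+n. f (params_at i \<omega>)) < 0"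
      by blast
    have "(\<Sum>i=1..n. f (params_at i \<omega>)) < 0" if "n0 \<le> n" for n
      using n0[OF that, of 0] \<open>1 < \<sigma>\<close> by simp
    then show ?case by blast
  qed
  with \<open>0 < \<delta>\<close> show ?thesis unfolding f_eq by (rule that)
qed

end

theorem corollary1:
  fixes M :: "'w measure"
    and A B :: real
    and a b p :: "nat \<Rightarrow> 'w \<Rightarrow> real"
    and \<mu> :: "'w \<Rightarrow> real measure"
    and \<alpha> :: real
  assumes params: "random_moran_parameters M A B a b p"
    and mu: "\<And>\<omega>. \<omega> \<in> space M \<Longrightarrow> moran_measure (\<lambda>n. a n \<omega>) (\<lambda>n. b n \<omega>) (\<lambda>n. p n \<omega>) (\<mu> \<omega>)"
    and alpha: "\<alpha> \<ge> 0" "G_fun M a b p \<alpha> = \<alpha>"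
    and above: "\<And>\<psi>. \<psi> > \<alpha> \<Longrightarrow> G_fun M a b p \<psi> < \<psi>"
  shows "\<exists>\<Gamma>\<in>sets M. measure M \<Gamma> = 1 \<and>
    (\<forall>\<Phi>. large_dimension_function \<Phi> \<longrightarrow> (\<forall>\<omega>\<in>\<Gamma>. upper_dim \<Phi> (\<mu> \<omega>) = ereal \<alpha>))"
proof -
  have "prob_space M"
    using params unfolding random_moran_parameters_def by (rule conjunct1)
  then interpret random_moran M A B a b p
    using params by (intro random_moran.intro random_moran_axioms.intro)
  define u where "u k = \<alpha> + 1 / real (Suc k)" for k
  define l where "l k = \<alpha> - 1 / real (Suc k)" for k
  define sums_above where "sums_above k \<sigma> \<omega> \<longleftrightarrow> (\<exists>n0. \<forall>n\<ge>n0. \<forall>N. real N \<le> \<sigma> ^ n \<longrightarrow>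
      (\<Sum>i=N+1..N+n. u k * Z_val (u k) (a i \<omega>) (b i \<omega>) (p i \<omega>)
        - Y_val (u k) (a i \<omega>) (b i \<omega>) (p i \<omega>)) < 0)" for k \<sigma> \<omega>
  define sums_below where "sums_below k \<delta> \<omega> \<longleftrightarrow> (\<exists>n0. \<forall>n\<ge>n0.
      (\<Sum>i=1..n. Y_val \<alpha> (a i \<omega>) (b i \<omega>) (p i \<omega>)
        - l k * Z_val \<alpha> (a i \<omega>) (b i \<omega>) (p i \<omega>) + \<delta>) < 0)" for k \<delta> \<omega>
  have "\<exists>\<sigma>>1. AE \<omega> in M. sums_above k \<sigma> \<omega>" for k
  proof -
    have "\<alpha> < u k" by (simp add: u_def)
    then have "0 \<le> u k" "G_fun M a b p (u k) < u k" using alpha(1) above by simp_all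
    then obtain \<sigma> :: real where "1 < \<sigma>" "AE \<omega> in M. sums_above k \<sigma> \<omega>"
      unfolding sums_above_def by (rule blocks_above)
    then show ?thesis by blast
  qed
  then obtain \<sigma> where \<sigma>: "\<And>k. 1 < \<sigma> k" "\<And>k. AE \<omega> in M. sums_above k (\<sigma> k) \<omega>"
    by metis
  have "\<exists>\<delta>>0. AE \<omega> in M. sums_below k \<delta> \<omega>" for k
  proof -
    have "l k < \<alpha>" by (simp add: l_def)
    with alpha(2) obtain \<delta> where "0 < \<delta>" "AE \<omega> in M. sums_below k \<delta> \<omega>"
      unfolding sums_below_def by (rule sums_below)
    then show ?thesis by blast
  qed
  then obtain \<delta> where \<delta>: "\<And>k. 0 < \<delta> k" "\<And>k. AE \<omega> in M. sums_below k (\<delta> k) \<omega>"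
    by metis
  have "AE \<omega> in M. (\<forall>n\<ge>1. 0 < p n \<omega> \<and> p n \<omega> < 1) \<and>
      (\<forall>k. sums_above k (\<sigma> k) \<omega>) \<and> (\<forall>k. sums_below k (\<delta> k) \<omega>)"
    (is "AE \<omega> in M. ?good \<omega>")
    by (intro AE_conjI weights_AE AE_all_countable[THEN iffD2] allI \<sigma>(2) \<delta>(2))
  then obtain N where N: "{\<omega>\<in>space M. \<not> ?good \<omega>} \<subseteq> N" "emeasure M N = 0" "N \<in> sets M"
    by (rule AE_E)
  have "upper_dim \<Phi> (\<mu> \<omega>) = ereal \<alpha>" if large: "large_dimension_function \<Phi>" and \<omega>: "\<omega> \<in> space M - N" for \<Phi> \<omega>
  proof -
    have in_space: "\<omega> \<in> space M" using \<omega> by simp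
    have good: "?good \<omega>" using \<omega> N(1) by blast
    interpret S: moran_system A B "\<lambda>n. a n \<omega>" "\<lambda>n. b n \<omega>" "\<lambda>n. p n \<omega>" "\<mu> \<omega>"
      using A_B params_range[OF in_space] mu[OF in_space] good by unfold_locales auto
    have "upper_dim \<Phi> (\<mu> \<omega>) \<le> ereal (u k)" for k
    proof -
      from good have "sums_above k (\<sigma> k) \<omega>" by blast
      then obtain n0 where n0: "\<And>n N. n0 \<le> n \<Longrightarrow> real N \<le> \<sigma> k ^ n \<Longrightarrow>
          (\<Sum>i=N+1..N+n. u k * Z_val (u k) (a i \<omega>) (b i \<omega>) (p i \<omega>) - Y_val (u k) (a i \<omega>) (b i \<omega>) (p i \<omega>)) < 0"
        unfolding sums_above_def by blast
      have "0 \<le> u k" using alpha(1) by (simp add: u_def)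
      then show ?thesis
        by (rule S.upper_dim_le[OF large _ \<sigma>(1)]) (rule less_imp_le[OF n0])
    qed
    moreover have "(\<lambda>k. ereal (u k)) \<longlonglongrightarrow> ereal (\<alpha> + 0)"
      unfolding u_def by (intro tendsto_intros LIMSEQ_Suc lim_1_over_n)
    ultimately have le: "upper_dim \<Phi> (\<mu> \<omega>) \<le> ereal \<alpha>" by (auto intro: LIMSEQ_le_const)
    have "ereal (l k) \<le> upper_dim \<Phi> (\<mu> \<omega>)" for k
    proof -
      from good have "sums_below k (\<delta> k) \<omega>" by blast
      then obtain n0 where n0: "\<And>n. n0 \<le> n \<Longrightarrow>
          (\<Sum>i=1..n. Y_val \<alpha> (a i \<omega>) (b i \<omega>) (p i \<omega>) - l k * Z_val \<alpha> (a i \<omega>) (b i \<omega>) (p i \<omega>) + \<delta> k) < 0"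
        unfolding sums_below_def by blast
      have nonneg: "0 \<le> \<Phi> t" if "0 < t" "t < 1" for t
        using large that by (auto simp: large_dimension_function_def dimension_function_def)
      show ?thesis
        by (rule S.upper_dim_ge[OF nonneg \<delta>(1) less_imp_le[OF n0]])
    qed
    moreover have "(\<lambda>k. ereal (l k)) \<longlonglongrightarrow> ereal (\<alpha> - 0)"
      unfolding l_def by (intro tendsto_intros LIMSEQ_Suc lim_1_over_n)
    ultimately have "ereal \<alpha> \<le> upper_dim \<Phi> (\<mu> \<omega>)" by (auto intro: LIMSEQ_le_const2)
    with le show ?thesis by (rule antisym)
  qed
  moreover have "measure M (space M - N) = 1"
    using N(2,3) by (subst prob_compl) (simp_all add: measure_def)
  ultimately show ?thesis using N(3) by (intro bexI[of _ "space M - N"]) auto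
qed

end
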